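(* If $G$ is a $2$-connected non-complete graph on $n$ vertices that is not isomorphic to $K^2_n$ or $K^{n-2}_n$, then $\eta(G)\ge 2n-5$.
   Context: All graphs are finite and simple; a $2$-connected graph has at least $3$ vertices. For $n,t\in\mathbb{N}$ with $1\le t\le n-1$, $K^t_n$ denotes the graph obtained from the complete graph $K_{n-1}$ by adding one new vertex adjacent to exactly $t$ of the $n-1$ old vertices. For a connected graph $G=(V,E)$, $d(a,b)$ is the length of a shortest path between $a$ and $b$. The Wiener index is $W(G)=\sum_{\{a,b\}\subseteq V} d(a,b)$ (sum over unordered pairs of vertices). The Szeged index is $\mathrm{Sz}(G)=\sum_{ab\in E} n_{ab}(a)\cdot n_{ab}(b)$, where $n_{ab}(a)$ is the number of vertices strictly closer to $a$ than to $b$, and $n_{ab}(b)$ is the number of vertices strictly closer to $b$ than to $a$. Define $\eta(G)=\mathrm{Sz}(G)-W(G)$. *)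

theory Defs
  imports "Graph_Theory.Graph_Theory"
begin

text \<open>
  A finite simple graph is a \<open>pair_graph\<close>: a finite vertex set with a symmetric irreflexive
  adjacency relation \<open>parcs\<close>. Each undirected edge \<open>{a, b}\<close> is present as the two arcs
  \<open>(a, b)\<close> and \<open>(b, a)\<close>, so sums over undirected edges are taken over \<open>edges\<close> below.
\<close>

definition edges :: "'a pair_pre_digraph \<Rightarrow> 'a set set" where
  "edges G = {{a, b} | a b. (a, b) \<in> parcs G}"

text \<open>The value of a symmetric binary function on an unordered pair.\<close>

definition on_pair :: "('a \<Rightarrow> 'a \<Rightarrow> 'c) \<Rightarrow> 'a set \<Rightarrow> 'c" where
  "on_pair f e = (THE k. \<exists>a b. e = {a, b} \<and> k = f a b)"

lemma on_pair_eq: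
  assumes "\<And>a b. f a b = f b a"
  shows "on_pair f {a, b} = f a b"
  unfolding on_pair_def using assms by (intro the_equality) (auto simp only: doubleton_eq_iff)

text \<open>Junk value \<open>LEAST k. False\<close> if there is no path from \<open>a\<close> to \<open>b\<close>.\<close>

definition gdist :: "'a pair_pre_digraph \<Rightarrow> 'a \<Rightarrow> 'a \<Rightarrow> nat" where
  "gdist G a b = (LEAST k. \<exists>p. pre_digraph.apath (with_proj G) a p b \<and> length p = k)"

lemma (in pair_sym_digraph) gdist_commute: "gdist G a b = gdist G b a"
proof -
  have len: "length (rev_path p) = length p" for p :: "('a \<times> 'a) list"
    by (induction p) auto
  have "\<exists>q. apath v q u \<and> length q = length p" if "apath u p v" for u v p
    using that len by (intro exI[of _ "rev_path p"]) simp
  then have "(\<exists>p. apath a p b \<and> length p = k) \<longleftrightarrow> (\<exists>p. apath b p a \<and> length p = k)" for k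
    by metis
  then show ?thesis unfolding gdist_def by simp
qed

text \<open>Agreement with the library's weighted distance for unit weights.\<close>

lemma (in pair_graph) gdist_eq_mu:
  assumes "a \<rightarrow>\<^sup>*\<^bsub>with_proj G\<^esub> b"
  shows "ereal (real (gdist G a b)) = \<mu> (\<lambda>_. 1) a b"
proof -
  have cost: "awalk_cost (\<lambda>_. 1) p = real (length p)" for p :: "('a \<times> 'a) list"
    by (simp add: awalk_cost_def sum_list_triv)
  obtain p0 where "apath a p0 b"
    using assms by (auto simp: reachable_apath)
  then have ex: "\<exists>k p. apath a p b \<and> length p = k" by blast
  have "\<exists>p. apath a p b \<and> length p = gdist G a b"
    unfolding gdist_def by (rule LeastI_ex[OF ex])
  then obtain p where p: "apath a p b" "length p = gdist G a b" by blast
  have le: "gdist G a b \<le> length q" if "awalk a q b" for q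
  proof -
    have "apath a (awalk_to_apath q) b"
      using that by (rule apath_awalk_to_apath)
    then have "gdist G a b \<le> length (awalk_to_apath q)"
      unfolding gdist_def by (intro Least_le exI[of _ "awalk_to_apath q"] conjI) simp_all
    also have "\<dots> \<le> length q"
      using awalk_to_path_no_neg_cyc_cost[OF that, of "\<lambda>_. 1"] by (simp add: cost)
    finally show ?thesis .
  qed
  show ?thesis unfolding \<mu>_def
  proof (rule INF_eqI[symmetric])
    fix q assume "q \<in> {p. awalk a p b}"
    then show "ereal (real (gdist G a b)) \<le> ereal (awalk_cost (\<lambda>_. 1) q)"
      using le by (simp add: cost)
  next
    fix y assume "\<And>q. q \<in> {p. awalk a p b} \<Longrightarrow> y \<le> ereal (awalk_cost (\<lambda>_. 1) q)"
    from this[of p] show "y \<le> ereal (real (gdist G a b))"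
      using p awalkI_apath[OF p(1)] by (simp add: cost)
  qed
qed

definition wiener_index :: "'a pair_pre_digraph \<Rightarrow> nat" where
  "wiener_index G = (\<Sum>e | e \<subseteq> pverts G \<and> card e = 2. on_pair (gdist G) e)"

definition closer :: "'a pair_pre_digraph \<Rightarrow> 'a \<Rightarrow> 'a \<Rightarrow> nat" where
  "closer G a b = card {x \<in> pverts G. gdist G x a < gdist G x b}"

definition szeged_index :: "'a pair_pre_digraph \<Rightarrow> nat" where
  "szeged_index G = (\<Sum>e\<in>edges G. on_pair (\<lambda>a b. closer G a b * closer G b a) e)"

lemma (in pair_sym_digraph) wiener_summand: "on_pair (gdist G) {a, b} = gdist G a b"
  by (rule on_pair_eq) (rule gdist_commute)

lemma szeged_summand:
  "on_pair (\<lambda>a b. closer G a b * closer G b a) {a, b} = closer G a b * closer G b a"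
  by (rule on_pair_eq) (rule mult.commute)

definition eta :: "'a pair_pre_digraph \<Rightarrow> int" where
  "eta G = int (szeged_index G) - int (wiener_index G)"

definition two_connected :: "'a pair_pre_digraph \<Rightarrow> bool" where
  "two_connected G \<longleftrightarrow> 3 \<le> card (pverts G) \<and> connected (with_proj G)
     \<and> (\<forall>v\<in>pverts G. connected (pre_digraph.del_vert (with_proj G) v))"

text \<open>
  \<open>K\<^sup>t\<^sub>n\<close>, intended for \<open>1 \<le> t \<le> n - 1\<close>: the complete graph on \<open>{0..<n-1}\<close> together with the
  new vertex \<open>n - 1\<close>, which is adjacent to exactly the old vertices \<open>0, \<dots>, t - 1\<close>.
\<close>

definition K_sup :: "nat \<Rightarrow> nat \<Rightarrow> nat pair_pre_digraph" where
  "K_sup n t = \<lparr> pverts = {..<n},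
     parcs = {(u, v). u < n - 1 \<and> v < n - 1 \<and> u \<noteq> v}
       \<union> {..<t} \<times> {n - 1} \<union> {n - 1} \<times> {..<t} \<rparr>"

lemma pair_graph_K_sup:
  assumes "1 \<le> t" "t \<le> n - 1"
  shows "pair_graph (K_sup n t)"
proof -
  have sub: "parcs (K_sup n t) \<subseteq> {..<n} \<times> {..<n}"
    using assms by (auto simp: K_sup_def)
  then have "finite (parcs (K_sup n t))"
    by (rule finite_subset) simp
  moreover have "finite (pverts (K_sup n t))" by (simp add: K_sup_def)
  moreover have "sym (parcs (K_sup n t))" by (auto simp: K_sup_def sym_def)
  moreover have "fst e \<noteq> snd e" if "e \<in> parcs (K_sup n t)" for e
    using that assms by (auto simp: K_sup_def)
  moreover have "fst e < n \<and> snd e < n" if "e \<in> parcs (K_sup n t)" for e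
    using that sub by auto
  moreover have "pverts (K_sup n t) = {..<n}" by (simp add: K_sup_def)
  ultimately show ?thesis
    by unfold_locales (simp_all add: symmetric_def)
qed

end

theory Submission
  imports Defs
begin

text \<open>
  For vertices \<open>x\<close>, \<open>y\<close> let \<open>sep x y\<close> be the set of arcs \<open>(a, b)\<close> with \<open>a\<close> closer to \<open>x\<close> and \<open>b\<close>
  closer to \<open>y\<close>. It contains the arcs of every shortest path from \<open>x\<close> to \<open>y\<close>, so the excess
  \<open>ex x y = card (sep x y) - d x y\<close> is nonnegative, and counting pairs of a vertex pair and a
  separating edge in two ways shows that \<open>2 \<eta>(G)\<close> is the sum of \<open>ex x y\<close> over all ordered pairs.

  If every vertex that is not universal has total excess at least \<open>4\<close>, summing over the vertices
  suffices; with three or more universal vertices one also uses that they all are common neighbours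
  of each nonadjacent pair. Otherwise some nonuniversal \<open>z\<close> has total excess at most \<open>3\<close>.
  Two-connectedness then forces every vertex to be within distance \<open>2\<close> of \<open>z\<close>, and exactly one
  of two things happens: a single vertex \<open>w\<close> of the second sphere has two neighbours in the first
  one, or the second sphere splits into the private neighbourhoods of two vertices of the first
  one, joined by a single edge. In both cases all but four vertices can be charged with at least
  two units of excess and the remaining four with three, using no vertex pair twice.
\<close>

section \<open>Excess of a vertex pair\<close>

text \<open>Abstracts what the argument uses of distances in a finite connected graph: a metric in
  which distance 1 is adjacency and every vertex at positive distance has a neighbour one step
  closer. Walks appear only when these axioms are verified.\<close>

locale graph_metric =
  fixes V :: "'a set" and E :: "'a \<Rightarrow> 'a \<Rightarrow> bool" and d :: "'a \<Rightarrow> 'a \<Rightarrow> nat"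
  assumes finite_V: "finite V"
    and E_in_V: "E x y \<Longrightarrow> x \<in> V \<and> y \<in> V"
    and E_sym: "E x y \<Longrightarrow> E y x"
    and d_eq_0: "x \<in> V \<Longrightarrow> y \<in> V \<Longrightarrow> d x y = 0 \<longleftrightarrow> x = y"
    and d_eq_1: "x \<in> V \<Longrightarrow> y \<in> V \<Longrightarrow> d x y = 1 \<longleftrightarrow> E x y"
    and d_sym: "d x y = d y x"
    and d_tri: "x \<in> V \<Longrightarrow> y \<in> V \<Longrightarrow> w \<in> V \<Longrightarrow> d x w \<le> d x y + d y w"
    and d_pred: "x \<in> V \<Longrightarrow> y \<in> V \<Longrightarrow> d x y = Suc k \<Longrightarrow> \<exists>u. E u y \<and> d x u = k"
begin

lemma E_irrefl: "\<not> E x x"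
  using E_in_V d_eq_0 d_eq_1 by (metis zero_neq_one)

lemma E_neq: "E x y \<Longrightarrow> x \<noteq> y"
  using E_irrefl by blast

lemma E_commute: "E x y \<longleftrightarrow> E y x"
  using E_sym by blast

lemma E_d: "E x y \<Longrightarrow> d x y = 1"
  using E_in_V d_eq_1 by blast

lemma d_self: "x \<in> V \<Longrightarrow> d x x = 0"
  using d_eq_0 by blast

lemma E_step: "x \<in> V \<Longrightarrow> E a b \<Longrightarrow> d x b \<le> d x a + 1"
  using d_tri[of x a b] E_in_V[of a b] E_d[of a b] by auto

lemma d_ge_2: "x \<in> V \<Longrightarrow> y \<in> V \<Longrightarrow> x \<noteq> y \<Longrightarrow> \<not> E x y \<Longrightarrow> 2 \<le> d x y"
  using d_eq_0[of x y] d_eq_1[of x y] by linarith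

lemma d_2I: "E x u \<Longrightarrow> E u y \<Longrightarrow> x \<noteq> y \<Longrightarrow> \<not> E x y \<Longrightarrow> d x y = 2"
  using d_ge_2[of x y] d_tri[of x u y] E_in_V[of x u] E_in_V[of u y] E_d[of x u] E_d[of u y] by auto

lemma d_2E:
  assumes "x \<in> V" "y \<in> V" "d x y = 2"
  obtains u where "E x u" "E u y"
proof -
  obtain u where "E u y" "d x u = 1"
    using d_pred[of x y 1] assms by (auto simp: numeral_2_eq_2)
  then show thesis using that d_eq_1 E_in_V assms by blast
qed

lemma d_ge_3: "x \<in> V \<Longrightarrow> y \<in> V \<Longrightarrow> x \<noteq> y \<Longrightarrow> \<not> E x y \<Longrightarrow> (\<And>u. E x u \<Longrightarrow> E u y \<Longrightarrow> False) \<Longrightarrow> 3 \<le> d x y"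
  using d_ge_2[of x y] d_2E[of x y] by (metis le_antisym not_less_eq_eq numeral_2_eq_2 numeral_3_eq_3)

text \<open>Step back from \<open>y\<close> along predecessors until distance \<open>k\<close> from
  \<open>x\<close> is reached; the triangle inequality keeps the vertex found on a shortest
  path.\<close>

lemma geodesic_midpoint:
  assumes "x \<in> V" "y \<in> V" "k \<le> d x y"
  shows "\<exists>m\<in>V. d x m = k \<and> d x y = k + d m y"
  using assms
proof (induction "d x y - k" arbitrary: y)
  case 0
  then show ?case using d_self[of y] by (intro bexI[of _ y]) auto
next
  case (Suc j)
  then obtain l where l: "d x y = Suc l" by (cases "d x y") auto
  then obtain u where u: "E u y" "d x u = l" using d_pred Suc.prems by blast
  then have "\<exists>m\<in>V. d x m = k \<and> d x u = k + d m u"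
    using Suc.hyps(1)[of u] Suc.prems Suc.hyps(2) l E_in_V by auto
  then obtain m where m: "m \<in> V" "d x m = k" "d x u = k + d m u" by blast
  then have "d m y \<le> d m u + 1" using u E_step by blast
  moreover have "d x y \<le> d x m + d m y" using d_tri m Suc.prems by blast
  ultimately show ?case using m l u by (intro bexI[of _ m]) auto
qed

section \<open>Separating arcs, geodesic arcs and excess\<close>

definition sep :: "'a \<Rightarrow> 'a \<Rightarrow> ('a \<times> 'a) set" where
  "sep x y = {(a, b). E a b \<and> d x a < d x b \<and> d y b < d y a}"

text \<open>The arcs lying on some shortest path from \<open>x\<close> to \<open>y\<close>, oriented
  away from \<open>x\<close>.\<close>

definition geo :: "'a \<Rightarrow> 'a \<Rightarrow> ('a \<times> 'a) set" where
  "geo x y = {(a, b). E a b \<and> d x a + 1 + d b y = d x y}"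

text \<open>A separating edge occurs in \<open>sep x y\<close> in exactly one orientation, so the
  cardinality counts edges. The truncated subtraction loses nothing on vertices, as
  \<open>card_sep\<close> shows.\<close>

definition ex :: "'a \<Rightarrow> 'a \<Rightarrow> nat" where
  "ex x y = card (sep x y) - d x y"

lemma finite_sep: "finite (sep x y)"
  by (rule finite_subset[of _ "V \<times> V"]) (use E_in_V finite_V in \<open>auto simp: sep_def\<close>)

lemma finite_geo: "finite (geo x y)"
  by (rule finite_subset[of _ "V \<times> V"]) (use E_in_V finite_V in \<open>auto simp: geo_def\<close>)

lemma geo_subset_sep: "x \<in> V \<Longrightarrow> y \<in> V \<Longrightarrow> geo x y \<subseteq> sep x y"
proof (safe)
  fix a b assume xy: "x \<in> V" "y \<in> V" and "(a, b) \<in> geo x y"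
  then have ab: "E a b" "d x a + 1 + d b y = d x y" by (auto simp: geo_def)
  have "d x y \<le> d x b + d b y" "d x y \<le> d x a + d a y"
    using d_tri xy E_in_V[OF ab(1)] by blast+
  then show "(a, b) \<in> sep x y" using ab d_sym[of y] by (auto simp: sep_def)
qed

lemma sep_swap: "sep y x = prod.swap ` sep x y"
  using E_sym by (force simp: sep_def image_iff)

lemma ex_commute: "ex x y = ex y x"
  unfolding ex_def sep_swap[of y x] using d_sym[of x y]
  by (simp add: card_image)

text \<open>Induction along one shortest path: the geodesic arcs to a predecessor \<open>u\<close>
  of \<open>y\<close> remain geodesic for \<open>y\<close>, and \<open>(u, y)\<close> is
  new.\<close>

lemma d_le_card_geo:
  assumes "x \<in> V" "y \<in> V"
  shows "d x y \<le> card (geo x y)"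
  using assms
proof (induction "d x y" arbitrary: y)
  case (Suc k)
  then obtain u where u: "E u y" "d x u = k" using d_pred by metis
  then have uV: "u \<in> V" using E_in_V by blast
  have "insert (u, y) (geo x u) \<subseteq> geo x y"
  proof (safe)
    show "(u, y) \<in> geo x y" using u Suc d_self[of y] by (auto simp: geo_def)
    fix a b assume "(a, b) \<in> geo x u"
    then have ab: "E a b" "d x a + 1 + d b u = k" using u by (auto simp: geo_def)
    have "d b y \<le> d b u + 1" using E_step u E_in_V ab by blast
    moreover have "d x y \<le> d x a + d a y" "d a y \<le> 1 + d b y"
      using d_tri[of x a y] d_tri[of a b y] E_in_V[OF ab(1)] Suc E_d[OF ab(1)] by auto
    ultimately show "(a, b) \<in> geo x y" using ab Suc(2) by (auto simp: geo_def)
  qed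
  moreover have "(u, y) \<notin> geo x u" using u by (auto simp: geo_def)
  moreover have "k \<le> card (geo x u)" using Suc(1)[of u] u uV Suc by blast
  ultimately have "Suc k \<le> card (geo x y)"
    using card_mono[OF finite_geo, of "insert (u, y) (geo x u)" x y] finite_geo by auto
  then show ?case using Suc by simp
qed auto

lemma card_sep: "x \<in> V \<Longrightarrow> y \<in> V \<Longrightarrow> card (sep x y) = d x y + ex x y"
  using d_le_card_geo[of x y] card_mono[OF finite_sep geo_subset_sep, of x y] by (simp add: ex_def)

lemma card_le_ex:
  assumes "x \<in> V" "y \<in> V" "X \<subseteq> sep x y"
  shows "card X \<le> d x y + ex x y"
  using card_mono[OF finite_sep assms(3)] card_sep[OF assms(1,2)] by simp

lemma ex_ge_card: "x \<in> V \<Longrightarrow> y \<in> V \<Longrightarrow> X \<subseteq> sep x y \<Longrightarrow> d x y + k \<le> card X \<Longrightarrow> k \<le> ex x y"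
  using card_le_ex[of x y X] by simp

lemma sepI: "E a b \<Longrightarrow> d x a < d x b \<Longrightarrow> d y b < d y a \<Longrightarrow> (a, b) \<in> sep x y"
  by (simp add: sep_def)

text \<open>Keeps two sources of excess additive: surplus geodesic arcs, and separating arcs off all
  geodesics. \<open>X = {}\<close> gives the first alone; \<open>card_le_ex_nongeo\<close> is the
  second alone.\<close>

lemma geo_card_le_ex:
  assumes "x \<in> V" "y \<in> V" "X \<subseteq> sep x y" "X \<inter> geo x y = {}"
  shows "card (geo x y) + card X \<le> d x y + ex x y"
proof -
  have "finite X" using finite_subset[OF assms(3) finite_sep] .
  then have "card (geo x y) + card X = card (geo x y \<union> X)"
    using card_Un_disjoint finite_geo assms(4) by (metis Int_commute)
  also have "\<dots> \<le> card (sep x y)"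
    using assms geo_subset_sep finite_sep by (intro card_mono) auto
  finally show ?thesis using card_sep assms by simp
qed

lemma card_le_ex_nongeo:
  assumes "x \<in> V" "y \<in> V" "X \<subseteq> sep x y" "X \<inter> geo x y = {}"
  shows "card X \<le> ex x y"
  using geo_card_le_ex[OF assms] d_le_card_geo[OF assms(1,2)] by simp

lemma geo_mono:
  assumes "x \<in> V" "y \<in> V" "v \<in> V" "d x v = d x y + d y v"
  shows "geo x y \<union> geo y v \<subseteq> geo x v"
proof -
  have "d x v \<le> d x a + 1 + d b v" "d x a \<le> d x y + d y a" "d b v \<le> d b y + d y v"
    if "E a b" for a b
    using d_tri[of x a v] d_tri[of a b v] assms d_tri[of x y a] d_tri[of b y v] E_in_V[OF that]
      E_d[OF that] by auto
  then show ?thesis using assms(4) by (fastforce simp: geo_def)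
qed

text \<open>Besides one arc on each level, the last two levels carry one arc per predecessor.\<close>

lemma card_geo_predecessors:
  assumes "x \<in> V" "y \<in> V" "2 \<le> d x y"
    and P: "P \<noteq> {}" "\<And>p. p \<in> P \<Longrightarrow> E p y \<and> d x y = d x p + 1"
  shows "d x y + 2 * (card P - 1) \<le> card (geo x y)"
proof -
  obtain k where k: "d x y = Suc (Suc k)" using assms(3) by (metis Suc_le_D numeral_2_eq_2 Suc_le_mono)
  have finP: "finite P" using P finite_V E_in_V by (metis finite_subset subsetI)
  have "\<exists>g. E g p \<and> d x g = k" if "p \<in> P" for p
    using d_pred[of x p k] P(2)[OF that] k assms E_in_V by auto
  then obtain g where g: "\<And>p. p \<in> P \<Longrightarrow> E (g p) p \<and> d x (g p) = k" by metis
  obtain p0 where p0: "p0 \<in> P" using P by blast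
  let ?G = "geo x (g p0)"
  have gV: "g p0 \<in> V" using g p0 E_in_V by blast
  have dgy: "d (g p) y = 2" if "p \<in> P" for p
  proof -
    have "d (g p) y \<le> 2"
      using d_tri[of "g p" p y] g[OF that] P(2)[OF that] E_in_V E_d by (metis one_add_one)
    moreover have "d x y \<le> d x (g p) + d (g p) y" using d_tri g[OF that] E_in_V assms by blast
    ultimately show ?thesis using g[OF that] k by simp
  qed
  have dpy: "d p y = 1" if "p \<in> P" for p using P(2)[OF that] E_d by blast
  \<comment> \<open>At least \<open>k\<close> arcs lead to one grandparent \<open>g p0\<close>; each
    \<open>p\<close> in \<open>P\<close> adds one arc into it and one out of it. The total
    \<open>k + 2 * card P\<close> is the claimed bound. The map \<open>g\<close> may identify
    grandparents, since the arcs \<open>(g p, p)\<close> still have different heads.\<close>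
  have sub: "?G \<union> ((\<lambda>p. (g p, p)) ` P \<union> (\<lambda>p. (p, y)) ` P) \<subseteq> geo x y"
  proof -
    have "?G \<subseteq> geo x y"
      using geo_mono[of x "g p0" y] dgy[OF p0] g[OF p0] k gV assms by auto
    moreover have "(g p, p) \<in> geo x y" "(p, y) \<in> geo x y" if "p \<in> P" for p
      using g[OF that] P(2)[OF that] dpy[OF that] d_self[OF assms(2)] k by (auto simp: geo_def)
    ultimately show ?thesis by blast
  qed
  have "?G \<inter> ((\<lambda>p. (g p, p)) ` P \<union> (\<lambda>p. (p, y)) ` P) = {}"
  proof -
    have "k \<le> d x (g p)" "k \<le> d x p" if "p \<in> P" for p using g[OF that] P(2)[OF that] k by auto
    moreover have "d x (fst e) < k" if "e \<in> ?G" for e using that g[OF p0] by (auto simp: geo_def)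
    ultimately show ?thesis by (fastforce simp: not_less[symmetric])
  qed
  moreover have "(\<lambda>p. (g p, p)) ` P \<inter> (\<lambda>p. (p, y)) ` P = {}"
    using P(2) E_irrefl by blast
  ultimately have "card (?G \<union> ((\<lambda>p. (g p, p)) ` P \<union> (\<lambda>p. (p, y)) ` P)) = card ?G + (card P + card P)"
    using finP finite_geo by (simp add: card_Un_disjoint card_image inj_on_def)
  then have "card ?G + (card P + card P) \<le> card (geo x y)"
    using card_mono[OF finite_geo sub] by simp
  moreover have "k \<le> card ?G" using d_le_card_geo[of x "g p0"] g p0 gV assms by auto
  moreover have "card P \<ge> 1" using finP P(1) by (simp add: Suc_leI card_gt_0_iff)
  ultimately show ?thesis using k by linarith
qed

text \<open>Each common neighbour puts two arcs on geodesics, while the distance uses up only two in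
  all.\<close>

lemma ex_common_neighbours:
  assumes "x \<noteq> y" "\<not> E x y" "P \<noteq> {}" "\<And>p. p \<in> P \<Longrightarrow> E x p \<and> E p y"
  shows "2 * (card P - 1) \<le> ex x y"
proof -
  obtain p where p: "E x p" "E p y" using assms by blast
  then have V: "x \<in> V" "y \<in> V" using E_in_V by blast+
  have d: "d x y = 2" using d_2I[OF p] assms by blast
  have pred: "E q y \<and> d x y = d x q + 1" if "q \<in> P" for q
    using assms(4)[OF that] E_d[of x q] d by simp
  have "d x y + 2 * (card P - 1) \<le> card (geo x y)"
    using d by (intro card_geo_predecessors[OF V _ assms(3) pred]) simp_all
  then show ?thesis using geo_card_le_ex[OF V, of "{}"] by simp
qed

lemma ex_two_common_neighbours:
  assumes "x \<noteq> y" "\<not> E x y" "p \<noteq> q" "E x p" "E p y" "E x q" "E q y"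
  shows "2 \<le> ex x y"
  using ex_common_neighbours[of x y "{p, q}"] assms by auto

text \<open>\<open>M x\<close> is the set of partners whose pairs with \<open>x\<close> are charged
  to \<open>x\<close>. The strictly decreasing rank prevents a pair from being charged at both ends,
  so each charged pair occurs twice in the sum over ordered pairs.\<close>

lemma sum_ex_charge:
  fixes \<rho> :: "'a \<Rightarrow> nat"
  assumes "\<And>x. x \<in> V \<Longrightarrow> M x \<subseteq> V" and rank: "\<And>x y. x \<in> V \<Longrightarrow> y \<in> M x \<Longrightarrow> \<rho> y < \<rho> x"
  shows "2 * (\<Sum>x\<in>V. \<Sum>y\<in>M x. ex x y) \<le> (\<Sum>x\<in>V. \<Sum>y\<in>V. ex x y)"
proof -
  let ?O = "Sigma V M"
  have finM: "finite (M x)" if "x \<in> V" for x using assms(1)[OF that] finite_V finite_subset by blast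
  have finO: "finite ?O" using finM finite_V by auto
  have sub: "?O \<subseteq> V \<times> V" using assms(1) by blast
  have disj: "?O \<inter> prod.swap ` ?O = {}"
    using rank by (auto, meson less_asym)
  have "(\<Sum>x\<in>V. \<Sum>y\<in>M x. ex x y) = (\<Sum>(x, y)\<in>?O. ex x y)"
    using finM finite_V by (simp add: sum.Sigma)
  moreover have "(\<Sum>(x, y)\<in>prod.swap ` ?O. ex x y) = (\<Sum>(x, y)\<in>?O. ex x y)"
    by (subst sum.reindex) (auto simp: ex_commute intro!: sum.cong)
  ultimately have "2 * (\<Sum>x\<in>V. \<Sum>y\<in>M x. ex x y) = (\<Sum>(x, y)\<in>?O \<union> prod.swap ` ?O. ex x y)"
    using disj finO by (simp add: sum.union_disjoint)
  also have "\<dots> \<le> (\<Sum>(x, y)\<in>V \<times> V. ex x y)"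
    using sub finite_V by (intro sum_mono2) auto
  finally show ?thesis using finite_V by (simp add: sum.cartesian_product)
qed

text \<open>The final count: two units for each vertex outside \<open>Z\<close> and three for
  \<open>Z\<close> together give \<open>2 * (2 * (n - 4) + 3) = 4 * n - 10\<close>, where
  \<open>n\<close> is the number of vertices.\<close>

lemma sum_ex_charge_ge:
  fixes \<rho> :: "'a \<Rightarrow> nat"
  assumes "\<And>x. x \<in> V \<Longrightarrow> M x \<subseteq> V" "\<And>x y. x \<in> V \<Longrightarrow> y \<in> M x \<Longrightarrow> \<rho> y < \<rho> x"
    and Z: "Z \<subseteq> V" "card Z = 4" "3 \<le> (\<Sum>x\<in>Z. \<Sum>y\<in>M x. ex x y)"
    and rest: "\<And>x. x \<in> V - Z \<Longrightarrow> 2 \<le> (\<Sum>y\<in>M x. ex x y)"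
  shows "4 * card V \<le> (\<Sum>x\<in>V. \<Sum>y\<in>V. ex x y) + 10"
proof -
  let ?e = "\<lambda>x. \<Sum>y\<in>M x. ex x y"
  have "2 * card (V - Z) \<le> (\<Sum>x\<in>V - Z. ?e x)"
    using sum_mono[of "V - Z" "\<lambda>_. 2" ?e, OF rest] by simp
  moreover have "card (V - Z) = card V - 4" "4 \<le> card V"
    using Z card_mono[OF finite_V Z(1)] finite_subset[OF Z(1) finite_V] by (simp_all add: card_Diff_subset)
  moreover have "(\<Sum>x\<in>V. ?e x) = (\<Sum>x\<in>V - Z. ?e x) + (\<Sum>x\<in>Z. ?e x)"
    using sum.subset_diff[OF Z(1) finite_V] .
  moreover have "2 * (\<Sum>x\<in>V. ?e x) \<le> (\<Sum>x\<in>V. \<Sum>y\<in>V. ex x y)"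
    by (rule sum_ex_charge[of M \<rho>]) (use assms(1,2) in blast)+
  ultimately show ?thesis using Z(3) by linarith
qed

text \<open>A vertex at distance at least two from the root of a connected set \<open>T\<close> pairs up with the
  vertex two steps closer to the root: both see the vertex in between as well as \<open>p\<close>.\<close>

lemma fan_charge:
  assumes r: "r \<in> T" and p: "\<And>t. t \<in> T \<Longrightarrow> E p t"
    and conn: "\<And>X. X \<subseteq> T - {r} \<Longrightarrow> X \<noteq> {} \<Longrightarrow> \<exists>s\<in>X. \<exists>t\<in>T - X. E s t"
  shows "\<exists>q (\<rho> :: 'a \<Rightarrow> nat). \<forall>s\<in>T - {r}. \<not> E s r \<longrightarrow> q s \<in> T \<and> \<rho> (q s) < \<rho> s \<and> 2 \<le> ex s (q s)"
proof -
  define R where "R = {(x, y). E x y \<and> x \<in> T \<and> y \<in> T}"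
  have reach: "(r, s) \<in> R\<^sup>*" if "s \<in> T" for s
  proof (rule ccontr)
    assume "(r, s) \<notin> R\<^sup>*"
    let ?X = "{x \<in> T. (r, x) \<notin> R\<^sup>*}"
    have "?X \<subseteq> T - {r}" by auto
    moreover have "?X \<noteq> {}" using that \<open>(r, s) \<notin> R\<^sup>*\<close> by blast
    ultimately obtain x t where "x \<in> ?X" "t \<in> T - ?X" "E x t" using conn[of ?X] by blast
    then have "x \<in> T" "(r, x) \<notin> R\<^sup>*" "t \<in> T" "(r, t) \<in> R\<^sup>*" "E x t" by auto
    then have "(t, x) \<in> R" by (auto simp: R_def intro: E_sym)
    then show False using \<open>(r, t) \<in> R\<^sup>*\<close> \<open>(r, x) \<notin> R\<^sup>*\<close> by (meson rtrancl.rtrancl_into_rtrancl)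
  qed
  \<comment> \<open>The distance from \<open>r\<close> in the graph induced on \<open>T\<close>. A
    vertex other than \<open>r\<close> and not adjacent to it has rank at least 2, so it has a
    vertex \<open>u\<close> two steps closer; an edge from \<open>u\<close> to \<open>s\<close>
    would contradict minimality.\<close>
  define \<rho> where "\<rho> s = (LEAST n. (r, s) \<in> R ^^ n)" for s
  have rho: "(r, s) \<in> R ^^ \<rho> s" if "s \<in> T" for s
    unfolding \<rho>_def using rtrancl_imp_relpow[OF reach[OF that]] by (rule LeastI_ex)
  have rho_le: "\<rho> s \<le> n" if "(r, s) \<in> R ^^ n" for s n
    unfolding \<rho>_def using that by (rule Least_le)
  have "\<exists>u. u \<in> T \<and> \<rho> u < \<rho> s \<and> 2 \<le> ex s u" if s: "s \<in> T" "s \<noteq> r" "\<not> E s r" for s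
  proof -
    have "\<rho> s \<noteq> 0" using rho[OF s(1)] s(2) by (intro notI) auto
    moreover have "\<rho> s \<noteq> 1" using rho[OF s(1)] s(3) by (intro notI) (auto simp: R_def dest: E_sym)
    ultimately obtain m where m: "\<rho> s = Suc (Suc m)"
      by (metis One_nat_def not0_implies_Suc)
    then obtain u v where uv: "(r, u) \<in> R ^^ m" "(u, v) \<in> R" "(v, s) \<in> R"
      using rho[OF s(1)] by auto
    then have T: "u \<in> T" "v \<in> T" "E u v" "E v s" by (auto simp: R_def)
    have "\<rho> u < \<rho> s" using rho_le[OF uv(1)] m by simp
    moreover have "\<not> E u s"
    proof
      assume "E u s"
      then have "(r, s) \<in> R ^^ Suc m" using uv(1) T s by (auto simp: R_def)
      then show False using rho_le m by fastforce
    qed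
    moreover have "s \<noteq> u" using \<open>\<rho> u < \<rho> s\<close> by auto
    ultimately have "2 \<le> ex s u"
      using ex_two_common_neighbours[of s u p v] p[OF T(1)] p[OF T(2)] p[OF s(1)] T E_sym E_neq by metis
    then show ?thesis using \<open>\<rho> u < \<rho> s\<close> T by blast
  qed
  then have "\<forall>s\<in>T - {r}. \<exists>u. \<not> E s r \<longrightarrow> u \<in> T \<and> \<rho> u < \<rho> s \<and> 2 \<le> ex s u" by blast
  then show ?thesis by metis
qed

end

section \<open>Vertices of small total excess\<close>

text \<open>Two-connectedness in the form used later: after deletion of \<open>v\<close>, a nonempty
  set that misses some remaining vertex is still left by an edge.\<close>

locale biconnected_metric = graph_metric +
  assumes cut: "v \<in> V \<Longrightarrow> S \<subseteq> V - {v} \<Longrightarrow> S \<noteq> {} \<Longrightarrow> r \<in> V - {v} \<Longrightarrow> r \<notin> S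
    \<Longrightarrow> \<exists>s\<in>S. \<exists>t. t \<notin> S \<and> t \<noteq> v \<and> E s t"

text \<open>The budget of 3 is the source of most contradictions below: they exhibit distinct
  vertices whose excesses with \<open>z\<close> add up to at least 4.\<close>

locale low_excess_vertex = biconnected_metric +
  fixes z :: 'a
  assumes z_in_V: "z \<in> V" and excess_le_3: "(\<Sum>y\<in>V. ex z y) \<le> 3"
begin

lemma excess_subset: "Y \<subseteq> V \<Longrightarrow> (\<Sum>y\<in>Y. ex z y) \<le> 3"
  using excess_le_3 sum_mono2[OF finite_V, of Y "ex z"] by simp

lemma ex_le_3: "y \<in> V \<Longrightarrow> ex z y \<le> 3"
  using excess_subset[of "{y}"] by simp

lemma ex_sum2: "x \<in> V \<Longrightarrow> y \<in> V \<Longrightarrow> x \<noteq> y \<Longrightarrow> ex z x + ex z y \<le> 3"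
  using excess_subset[of "{x, y}"] by simp

lemma ex_sum3:
  "x \<in> V \<Longrightarrow> y \<in> V \<Longrightarrow> w \<in> V \<Longrightarrow> x \<noteq> y \<Longrightarrow> x \<noteq> w \<Longrightarrow> y \<noteq> w \<Longrightarrow> ex z x + ex z y + ex z w \<le> 3"
  using excess_subset[of "{x, y, w}"] by simp

lemma ex_sum4:
  "x \<in> V \<Longrightarrow> y \<in> V \<Longrightarrow> w \<in> V \<Longrightarrow> u \<in> V \<Longrightarrow> distinct [x, y, w, u]
    \<Longrightarrow> ex z x + ex z y + ex z w + ex z u \<le> 3"
  using excess_subset[of "{x, y, w, u}"] by simp

section \<open>Parents and forks in the breadth-first layering from \<open>z\<close>\<close>

definition par :: "'a \<Rightarrow> 'a \<Rightarrow> bool" where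
  "par a b \<longleftrightarrow> E a b \<and> d z b = d z a + 1"

lemma par_E: "par a b \<Longrightarrow> E a b" and par_d: "par a b \<Longrightarrow> d z b = d z a + 1"
  and par_in_V: "par a b \<Longrightarrow> a \<in> V" "par a b \<Longrightarrow> b \<in> V"
  using E_in_V by (auto simp: par_def)

lemma par_exists: "x \<in> V \<Longrightarrow> x \<noteq> z \<Longrightarrow> \<exists>a. par a x"
  using d_pred[OF z_in_V, of x "d z x - 1"] d_eq_0[OF z_in_V, of x] by (auto simp: par_def)

lemma level_cases: "E x y \<Longrightarrow> d z x = d z y \<or> par x y \<or> par y x"
  using E_step[OF z_in_V, of x y] E_step[OF z_in_V, of y x] E_commute[of x y] by (auto simp: par_def)

definition forked :: "'a \<Rightarrow> bool" where
  "forked y \<longleftrightarrow> (\<exists>p q. p \<noteq> q \<and> par p y \<and> par q y)"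

lemma forkedI: "par p y \<Longrightarrow> par q y \<Longrightarrow> p \<noteq> q \<Longrightarrow> forked y"
  by (auto simp: forked_def)

lemma forked_in_V: "forked y \<Longrightarrow> y \<in> V"
  using par_in_V by (auto simp: forked_def)

lemma par_z: "par p y \<Longrightarrow> d z y = 1 \<Longrightarrow> p = z"
  using d_eq_0[OF z_in_V] par_d par_in_V by fastforce

lemma forked_level: "forked y \<Longrightarrow> 2 \<le> d z y"
  unfolding forked_def using par_z par_d by (metis Suc_1 Suc_leI add.commute le_add1 le_neq_implies_less plus_1_eq_Suc)

lemma card_geo_forked:
  assumes "forked y" shows "d z y + 2 \<le> card (geo z y)"
proof -
  obtain p q where "p \<noteq> q" "par p y" "par q y" using assms by (auto simp: forked_def)
  then have "d z y + 2 * (card {p, q} - 1) \<le> card (geo z y)"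
    by (intro card_geo_predecessors z_in_V forked_in_V forked_level assms) (auto simp: par_def)
  then show ?thesis using \<open>p \<noteq> q\<close> by simp
qed

lemma ex_forked: "forked y \<Longrightarrow> 2 \<le> ex z y"
  using card_geo_forked[of y] geo_card_le_ex[OF z_in_V, of y "{}"] forked_in_V by auto

text \<open>Each fork costs two units, so two forks exceed the budget.\<close>

lemma forked_unique: "forked x \<Longrightarrow> forked y \<Longrightarrow> x = y"
  using ex_forked[of x] ex_forked[of y] ex_sum2[of x y] forked_in_V by fastforce

text \<open>A third parent would raise the geodesic surplus of \<open>y\<close> to 4.\<close>

lemma forked_two_parents:
  assumes "par p y" "par q y" "par r y" "p \<noteq> q"
  shows "r = p \<or> r = q"
proof (rule ccontr)
  assume "\<not> ?thesis"
  then have "card {p, q, r} = 3" using assms by auto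
  moreover have "forked y" using assms forkedI by blast
  moreover have "d z y + 2 * (card {p, q, r} - 1) \<le> card (geo z y)"
    using assms forked_level[OF \<open>forked y\<close>] forked_in_V[OF \<open>forked y\<close>]
    by (intro card_geo_predecessors z_in_V) (auto simp: par_def)
  ultimately show False
    using geo_card_le_ex[OF z_in_V, of y "{}"] ex_le_3[of y] forked_in_V by fastforce
qed

text \<open>\<open>b\<close> is adjacent to \<open>t\<close> and \<open>a\<close> is not, so the arc
  separates \<open>z\<close> from \<open>t\<close>; it is not geodesic because \<open>b\<close> is
  already on the level of \<open>t\<close>.\<close>

lemma horizontal_sep:
  assumes "E b t" "d z b = d z t" "par a b" "\<not> E a t"
  shows "(a, b) \<in> sep z t - geo z t"
proof -
  have V: "a \<in> V" "t \<in> V" using assms E_in_V par_in_V by blast+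
  have "a \<noteq> t" using assms par_d by fastforce
  then have "2 \<le> d a t" using d_ge_2 V assms by blast
  then show ?thesis using assms par_d[of a b] par_E E_d[of b t] by (auto simp: sep_def geo_def d_sym[of t])
qed

lemma card_le_ex_z: "y \<in> V \<Longrightarrow> X \<subseteq> sep z y - geo z y \<Longrightarrow> card X \<le> ex z y"
  using card_le_ex_nongeo[OF z_in_V] by blast

lemma ex_ge_1: "y \<in> V \<Longrightarrow> e \<in> sep z y - geo z y \<Longrightarrow> 1 \<le> ex z y"
  using card_le_ex_z[of y "{e}"] by simp

lemma ex_ge_2:
  assumes "y \<in> V" "e \<in> sep z y - geo z y" "f \<in> sep z y - geo z y" "e \<noteq> f"
  shows "2 \<le> ex z y"
  using card_le_ex_z[of y "{e, f}"] assms by simp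

lemma forked_ex_ge_3:
  assumes "forked y" "e \<in> sep z y - geo z y" shows "3 \<le> ex z y"
  using geo_card_le_ex[OF z_in_V forked_in_V[OF assms(1)], of "{e}"] card_geo_forked[OF assms(1)] assms(2)
  by auto

text \<open>The horizontal edges whose ends have no parent in common. Every parent arc into one end
  is then a nongeodesic separating arc for the other end, so both ends carry excess.\<close>

definition cross :: "'a \<Rightarrow> 'a \<Rightarrow> bool" where
  "cross b t \<longleftrightarrow> E b t \<and> d z b = d z t \<and> (\<forall>a. par a b \<longrightarrow> \<not> par a t)"

lemma cross_sym: "cross b t \<Longrightarrow> cross t b"
  using E_sym by (auto simp: cross_def)

lemma cross_sep:
  assumes "cross b t" "par a b" shows "(a, b) \<in> sep z t - geo z t"
proof (rule horizontal_sep)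
  show "\<not> E a t" using assms by (auto simp: cross_def par_def)
qed (use assms in \<open>auto simp: cross_def\<close>)

lemma cross_in_V: "cross b t \<Longrightarrow> b \<in> V" "cross b t \<Longrightarrow> t \<in> V"
  using E_in_V by (auto simp: cross_def)

lemma cross_neq_z: "cross b t \<Longrightarrow> b \<noteq> z"
  using d_self[OF z_in_V] d_eq_0[OF z_in_V] cross_in_V E_neq by (metis cross_def)

lemma cross_ex:
  assumes "cross b t" shows "1 \<le> ex z t"
  using par_exists[OF cross_in_V(1)[OF assms] cross_neq_z[OF assms]] cross_sep[OF assms]
    ex_ge_1[OF cross_in_V(2)[OF assms]] by blast

text \<open>Otherwise the two ends contribute 1 each and the fork contributes 2.\<close>

lemma cross_unforked:
  assumes "cross b t" "forked y" shows "b = y \<or> t = y"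
  using cross_ex[OF assms(1)] cross_ex[OF cross_sym[OF assms(1)]] ex_forked[OF assms(2)]
    ex_sum3[of b t y] cross_in_V[OF assms(1)] forked_in_V[OF assms(2)] assms(1) E_neq
  by (fastforce simp: cross_def)

text \<open>If \<open>p\<close> and \<open>q\<close> were not adjacent, the arc
  \<open>(p, y)\<close> would separate \<open>z\<close> from \<open>q\<close> and
  \<open>(q, y)\<close> would separate \<open>z\<close> from \<open>p\<close>, both off geodesics.
  With the two units of \<open>y\<close> this makes 4.\<close>

lemma forked_parents_adjacent:
  assumes "par p y" "par q y" "p \<noteq> q" shows "E p q"
proof (rule ccontr)
  assume nE: "\<not> E p q"
  have V: "p \<in> V" "q \<in> V" "y \<in> V" using assms par_in_V by blast+
  have dpq: "2 \<le> d p q" using d_ge_2 V assms(3) nE by blast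
  have "1 \<le> ex z q" by (rule ex_ge_1[of _ "(p, y)"])
    (use assms V dpq E_d[of q y] in \<open>auto simp: par_def sep_def geo_def d_sym[of q p] d_sym[of y q]\<close>)
  moreover have "1 \<le> ex z p" by (rule ex_ge_1[of _ "(q, y)"])
    (use assms V dpq E_d[of p y] in \<open>auto simp: par_def sep_def geo_def d_sym[of y p]\<close>)
  moreover have "p \<noteq> y" "q \<noteq> y" using assms par_E E_neq by blast+
  ultimately show False
    using ex_forked[OF forkedI[OF assms]] ex_sum3[OF V assms(3)] by simp
qed

text \<open>If \<open>c\<close> is not a parent of \<open>y\<close>, the arc \<open>(c, t)\<close>
  raises the excess of \<open>y\<close> to 3. As \<open>t\<close> is not a second fork, some parent
  \<open>r\<close> of \<open>y\<close> is not a parent of \<open>t\<close>, and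
  \<open>(r, y)\<close> gives \<open>t\<close> the fourth unit.\<close>

lemma forked_neighbour_parent:
  assumes "forked y" "E y t" "d z t = d z y" "par c t" shows "par c y"
proof (rule ccontr)
  assume nc: "\<not> par c y"
  have "\<not> E c y" using nc assms(3,4) by (simp add: par_def)
  then have "(c, t) \<in> sep z y - geo z y" using horizontal_sep[of t y c] assms E_sym by auto
  then have "3 \<le> ex z y" using forked_ex_ge_3 assms(1) by blast
  obtain p q where pq: "p \<noteq> q" "par p y" "par q y" using assms(1) by (auto simp: forked_def)
  have ty: "t \<noteq> y" using assms E_neq by blast
  have "\<not> (par p t \<and> par q t)" using forkedI[of p t q] pq forked_unique assms(1) ty by blast
  then obtain r where r: "par r y" "\<not> par r t" using pq by blast
  then have "\<not> E r t" using assms(3) by (auto simp: par_def)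
  then have "1 \<le> ex z t" using horizontal_sep[of y t r] r assms ex_ge_1[of t] E_in_V[OF assms(2)] by auto
  then show False using \<open>3 \<le> ex z y\<close> ex_sum2[of y t] ty E_in_V[OF assms(2)] by auto
qed

section \<open>Descendants, and the bound 2 on the depth\<close>

definition desc :: "'a \<Rightarrow> 'a set" where
  "desc u = {x \<in> V. x \<noteq> u \<and> d z x = d z u + d u x}"

lemma desc_level: "u \<in> V \<Longrightarrow> x \<in> desc u \<Longrightarrow> d z u < d z x"
  using d_eq_0[of u x] by (auto simp: desc_def)

lemma desc_child:
  assumes "u \<in> V" "x \<in> insert u (desc u)" "par x y" shows "y \<in> desc u"
proof -
  have y: "y \<in> V" "x \<in> V" "E x y" "d z y = d z x + 1"
    using assms par_in_V par_E par_d by blast+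
  have "d z x = d z u + d u x" using assms d_self[of u] by (auto simp: desc_def)
  moreover have "d u y \<le> d u x + 1" using E_step assms y by blast
  moreover have "d z y \<le> d z u + d u y" using d_tri z_in_V assms y by blast
  ultimately show ?thesis using y d_self[OF assms(1)] by (auto simp: desc_def)
qed

lemma desc_parent:
  assumes "u \<in> V" "y \<in> desc u" shows "\<exists>x\<in>insert u (desc u). par x y"
proof -
  have y: "y \<in> V" "y \<noteq> u" "d z y = d z u + d u y" using assms by (auto simp: desc_def)
  then obtain k where k: "d u y = Suc k" using d_eq_0 assms by (metis not0_implies_Suc)
  then obtain x where x: "E x y" "d u x = k" using d_pred y assms by blast
  have xV: "x \<in> V" using x E_in_V by blast
  have "d z x \<le> d z u + d u x" using d_tri z_in_V assms xV by blast
  moreover have "d z y \<le> d z x + 1" using E_step z_in_V x by blast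
  ultimately have "d z x = d z u + d u x" "par x y" using y x k by (auto simp: par_def)
  then show ?thesis using xV by (auto simp: desc_def)
qed

text \<open>Deleting \<open>u\<close> must not cut its descendants off from \<open>z\<close>. Since
  descendants are closed under children, the edge that leaves them goes sideways or up, and the
  parent \<open>c\<close> of its inner end cannot be a parent of its outer end.\<close>

lemma desc_escape:
  assumes "u \<in> V" "u \<noteq> z" "desc u \<noteq> {}"
  obtains s t c where "s \<in> desc u" "t \<notin> insert u (desc u)" "c \<in> insert u (desc u)" "par c s"
    "E s t" "\<not> par c t" "d z t = d z s \<or> par t s"
proof -
  have "z \<notin> desc u" using desc_level[OF assms(1)] d_self[OF z_in_V] by fastforce
  moreover have "desc u \<subseteq> V - {u}" by (auto simp: desc_def)
  ultimately obtain s t where st: "s \<in> desc u" "t \<notin> desc u" "t \<noteq> u" "E s t"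
    using cut[OF assms(1) _ assms(3), of z] z_in_V assms by blast
  obtain c where c: "c \<in> insert u (desc u)" "par c s" using desc_parent[OF assms(1) st(1)] by blast
  have "\<not> par c t" "\<not> par s t" using desc_child[OF assms(1)] c st by blast+
  then show thesis using that[of s t c] st c level_cases[OF st(4)] by force
qed

text \<open>A deeper fork has adjacent parents \<open>p\<close>, \<open>q\<close> with a common
  parent \<open>g\<close> different from \<open>z\<close>. The edge escaping from the descendants of
  \<open>g\<close> would create a second fork, a forbidden cross edge, or another parent of
  \<open>y\<close>.\<close>

lemma forked_level_eq_2:
  assumes "forked y" shows "d z y = 2"
proof (rule ccontr)
  assume "d z y \<noteq> 2"
  then have L: "3 \<le> d z y" using forked_level[OF assms] by simp
  obtain p q where pq: "p \<noteq> q" "par p y" "par q y" using assms by (auto simp: forked_def)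
  have lev: "d z p = d z q" "2 \<le> d z p" using par_d[OF pq(2)] par_d[OF pq(3)] L by simp_all
  have pz: "p \<noteq> z" using lev d_self[OF z_in_V] by auto
  have Epq: "E p q" using forked_parents_adjacent pq by blast
  have "\<not> cross p q" using cross_unforked[OF _ assms, of p q] pq par_E E_neq by blast
  then obtain g where g: "par g p" "par g q" using Epq lev by (auto simp: cross_def)
  have gV: "g \<in> V" "g \<noteq> z" using g par_in_V par_d[OF g(1)] lev d_self[OF z_in_V] by auto
  have pD: "p \<in> desc g" "q \<in> desc g" using desc_child[OF gV(1)] g by blast+
  then have yD: "y \<in> desc g" using desc_child[OF gV(1)] pq by blast
  obtain s t c where e: "s \<in> desc g" "t \<notin> insert g (desc g)" "c \<in> insert g (desc g)" "par c s"
    "E s t" "\<not> par c t" "d z t = d z s \<or> par t s"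
    using desc_escape[OF gV] pD by blast
  have ty: "t \<noteq> y" using e yD by blast
  show False
  proof (cases "par t s")
    case True
    then have "forked s" using forkedI[OF e(4)] e by blast
    then have "s = y" using forked_unique assms by blast
    then have "t = p \<or> t = q" using forked_two_parents[OF pq(2,3)] True pq by blast
    then show False using pD e by blast
  next
    case False
    then have ht: "d z t = d z s" using e by blast
    have tz: "t \<noteq> z" using ht desc_level[OF gV(1) e(1)] d_self[OF z_in_V] by auto
    then obtain c' where c': "par c' t" using par_exists E_in_V e by blast
    have c'D: "c' \<notin> insert g (desc g)" using desc_child[OF gV(1) _ c'] e by blast
    show False
    proof (cases "s = y")
      case True
      then have "par c' y" using forked_neighbour_parent[OF assms _ _ c'] e ht by blast
      then have "c' = p \<or> c' = q" using forked_two_parents pq by blast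
      then show False using c'D pD by blast
    next
      case False
      then have "\<not> cross s t" using cross_unforked[OF _ assms] ty by blast
      then obtain a where a: "par a s" "par a t" using e ht by (auto simp: cross_def)
      have "a \<noteq> c" using a e by blast
      then have "forked s" using forkedI a e by blast
      then show False using forked_unique assms False by blast
    qed
  qed
qed

text \<open>The inner end has a single parent \<open>c\<close>, which lies inside. So the escaping
  edge cannot go up, and its ends share no parent.\<close>

lemma unforked_escape:
  assumes "u \<in> V" "u \<noteq> z" "desc u \<noteq> {}" and unf: "\<And>s. s \<in> desc u \<Longrightarrow> \<not> forked s"
  obtains s t where "s \<in> desc u" "t \<notin> insert u (desc u)" "cross s t"
proof -
  obtain s t c where e: "s \<in> desc u" "t \<notin> insert u (desc u)" "c \<in> insert u (desc u)" "par c s"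
    "E s t" "\<not> par c t" "d z t = d z s \<or> par t s"
    using desc_escape[OF assms(1-3)] by blast
  have only: "a = c" if "par a s" for a using forkedI that e unf by blast
  then have "\<not> par t s" using e by blast
  moreover have "\<not> par a t" if "par a s" for a using only[OF that] e by simp
  ultimately have "cross s t" using e by (auto simp: cross_def)
  then show thesis using that e by blast
qed

text \<open>A vertex on level 3 or deeper yields a cross edge below some \<open>u\<close> of level
  2, and a second one leaving the descendants of some \<open>a\<close> of level 1. On level 2 or
  higher up the second is disjoint from the first, giving four vertices with excess; otherwise both
  of its own ends have excess 2.\<close>

lemma level_le_2:
  assumes "x \<in> V" shows "d z x \<le> 2"
proof (rule ccontr)
  assume "\<not> ?thesis"
  then have L: "3 \<le> d z x" by simp
  obtain u where u: "u \<in> V" "d z u = 2" "d z x = 2 + d u x"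
    using geodesic_midpoint[OF z_in_V assms, of 2] L by auto
  obtain a where a: "a \<in> V" "d z a = 1" "d z x = 1 + d a x" "d z u = 1 + d a u"
  proof -
    obtain a where a: "a \<in> V" "d z a = 1" "d z u = 1 + d a u"
      using geodesic_midpoint[OF z_in_V u(1), of 1] u by auto
    have "d a x \<le> d a u + d u x" "d z x \<le> d z a + d a x" using d_tri a u assms z_in_V by blast+
    then show thesis using that[of a] a u by auto
  qed
  have nz: "u \<noteq> z" "a \<noteq> z" using u a d_self[OF z_in_V] by auto
  have Du: "x \<in> desc u" using L u assms by (auto simp: desc_def)
  have Da: "x \<in> desc a" using L a assms by (auto simp: desc_def)
  have "\<not> forked s" if "s \<in> desc u" for s
    using desc_level[OF u(1) that] u forked_level_eq_2 by fastforce
  then obtain s t where st: "s \<in> desc u" "t \<notin> insert u (desc u)" "cross s t"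
    using unforked_escape[OF u(1) nz(1)] Du by blast
  have lst: "3 \<le> d z s" "d z t = d z s" using desc_level[OF u(1) st(1)] u st(3) by (auto simp: cross_def)
  \<comment> \<open>A fork would have to be \<open>s\<close> or \<open>t\<close>, but forks lie on
    level 2 and these two lie deeper.\<close>
  have unf: "\<not> forked y" for y
    using cross_unforked[OF st(3)] forked_level_eq_2 lst by fastforce
  then have uniq: "p = q" if "par p y" "par q y" for p q y using forkedI that by blast
  obtain s2 t2 where st2: "s2 \<in> desc a" "t2 \<notin> insert a (desc a)" "cross s2 t2"
    using unforked_escape[OF a(1) nz(2)] Da unf by blast
  have ex1: "1 \<le> ex z s" "1 \<le> ex z t" "1 \<le> ex z s2" "1 \<le> ex z t2"
    using cross_ex st st2 cross_sym by blast+
  have nst: "s2 \<noteq> t2" "s \<noteq> t" using st2 st E_neq by (auto simp: cross_def)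
  show False
  proof (cases "d z s2 \<ge> 3")
    case False
    have "d z t2 = d z s2" using st2(3) by (simp add: cross_def)
    then have "distinct [s, t, s2, t2]" using False lst nst by auto
    then show False using ex_sum4[of s t s2 t2] ex1 cross_in_V[OF st(3)] cross_in_V[OF st2(3)] by simp
  next
    case True
    have sV: "s2 \<in> V" "t2 \<in> V" using cross_in_V st2 by blast+
    have h: "E s2 t2" "d z t2 = d z s2" using st2(3) by (auto simp: cross_def)
    obtain c where c: "c \<in> insert a (desc a)" "par c s2" using desc_parent[OF a(1) st2(1)] by blast
    have "d z c \<noteq> 1" using par_d[OF c(2)] True by simp
    then have "c \<noteq> a" using a by auto
    then obtain g where g: "g \<in> insert a (desc a)" "par g c" using desc_parent[OF a(1), of c] c by blast
    have "t2 \<noteq> z" using h True d_self[OF z_in_V] by auto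
    then obtain c' where c': "par c' t2" using par_exists sV by blast
    have c'D: "c' \<notin> insert a (desc a)" using desc_child[OF a(1) _ c'] st2 by blast
    have lc: "d z c + 1 = d z s2" "d z c' + 1 = d z s2" "d z g + 2 = d z s2"
      using par_d[OF c(2)] par_d[OF c'] par_d[OF g(2)] h by simp_all
    have "c' \<noteq> z" using lc True d_self[OF z_in_V] by auto
    then obtain g' where g': "par g' c'" using par_exists par_in_V c' by blast
    have lg': "d z g' + 2 = d z s2" using par_d[OF g'] lc by simp
    have gV: "g \<in> V" "g' \<in> V" "c \<in> V" "c' \<in> V" using par_in_V g g' by blast+
    have cross_c: "\<not> par c t2" "\<not> par c' s2" using st2(3) c c' by (auto simp: cross_def)
    have nEct: "\<not> E c t2" "\<not> E c' s2" using cross_c lc h by (auto simp: par_def)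
    \<comment> \<open>This makes \<open>(g, c)\<close> a second nongeodesic separating arc for
      \<open>t2\<close>, besides \<open>(c, s2)\<close>. A common neighbour of \<open>t2\<close> and
      \<open>g\<close> would be the unique parent \<open>c'\<close> of \<open>t2\<close> and put it
      below \<open>a\<close>.\<close>
    have far: "3 \<le> d t2 g"
    proof (rule d_ge_3)
      show "t2 \<noteq> g" "\<not> E t2 g" using lc h E_step[OF z_in_V, of g t2] E_sym by auto
      fix m assume m: "E t2 m" "E m g"
      have "d z t2 \<le> d z m + 1" "d z m \<le> d z g + 1" 
        using E_step[OF z_in_V E_sym[OF m(1)]] E_step[OF z_in_V E_sym[OF m(2)]] by auto
      then have "par m t2" "par g m" using m lc h E_sym by (auto simp: par_def)
      then have "par g c'" using uniq c' by blast
      then show False using c'D desc_child[OF a(1) g(1)] by blast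
    qed (use sV gV in auto)
    have far': "3 \<le> d s2 g'"
    proof (rule d_ge_3)
      show "s2 \<noteq> g'" "\<not> E s2 g'" using lg' h E_step[OF z_in_V, of g' s2] E_sym by auto
      fix m assume m: "E s2 m" "E m g'"
      have "d z s2 \<le> d z m + 1" "d z m \<le> d z g' + 1" 
        using E_step[OF z_in_V E_sym[OF m(1)]] E_step[OF z_in_V E_sym[OF m(2)]] by auto
      then have "par m s2" "par g' m" using m lg' h E_sym by (auto simp: par_def)
      then have "g' = g" using uniq c g by blast
      then show False using c'D desc_child[OF a(1) g(1)] g' by blast
    qed (use sV gV in auto)
    have "t2 \<noteq> c" "s2 \<noteq> c'" using lc h by auto
    then have ct: "d t2 c = 2" "d s2 c' = 2"
      using d_2I[OF E_sym[OF h(1)] E_sym[OF par_E[OF c(2)]]] d_2I[OF h(1) E_sym[OF par_E[OF c']]]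
        nEct lc h(2) E_commute[of c t2] E_commute[of c' s2] by auto
    have "(g, c) \<in> sep z t2 - geo z t2"
      using par_E[OF g(2)] par_d[OF g(2)] far ct lc h by (auto simp: sep_def geo_def d_sym[of c])
    then have "2 \<le> ex z t2"
      using cross_sep[OF st2(3) c(2)] lc sV by (intro ex_ge_2[of _ "(g, c)" "(c, s2)"]) auto
    moreover have "(g', c') \<in> sep z s2 - geo z s2"
      using par_E[OF g'] par_d[OF g'] far' ct lg' h by (auto simp: sep_def geo_def d_sym[of c'])
    then have "2 \<le> ex z s2"
      using cross_sep[OF cross_sym[OF st2(3)] c'] lc lg' sV
      by (intro ex_ge_2[of _ "(g', c')" "(c', t2)"]) auto
    ultimately show False using ex_sum2[OF sV nst(1)] by simp
  qed
qed

section \<open>The two spheres around \<open>z\<close>\<close>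

lemma par_z_iff: "par z x \<longleftrightarrow> E z x"
  using E_d[of z x] d_self[OF z_in_V] by (auto simp: par_def)

lemma level_1_iff: "x \<in> V \<Longrightarrow> d z x = 1 \<longleftrightarrow> E z x"
  using d_eq_1 z_in_V by blast

lemma vertex_cases:
  assumes "x \<in> V" obtains "x = z" | "E z x" "d z x = 1" | "d z x = 2" "x \<noteq> z" "\<not> E z x"
proof -
  have "d z x = 0 \<or> d z x = 1 \<or> d z x = 2" using level_le_2[OF assms] by linarith
  then show thesis using that d_eq_0[OF z_in_V assms] level_1_iff[OF assms] by fastforce
qed

lemma par_level_2: "d z x = 2 \<Longrightarrow> par a x \<longleftrightarrow> E z a \<and> E a x"
  using E_in_V[of a x] level_1_iff[of a] by (auto simp: par_def)

lemma no_child_of_level_2: "d z x = 2 \<Longrightarrow> \<not> par x y"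
  using par_d[of x y] level_le_2[of y] par_in_V[of x y] by auto

lemma same_parent:
  assumes "E s t" "d z s = d z t" "par a s" "\<not> cross s t" "\<not> forked s"
  shows "par a t"
  using assms forkedI by (auto simp: cross_def)

lemma forked_not_cross: "forked w \<Longrightarrow> s \<noteq> w \<Longrightarrow> t \<noteq> w \<Longrightarrow> \<not> cross s t"
  using cross_unforked by blast

end

section \<open>A vertex with two parents\<close>

text \<open>\<open>z\<close>, \<open>p\<close>, \<open>q\<close>, \<open>w\<close> span a complete
  graph minus the edge between \<open>z\<close> and \<open>w\<close>.\<close>

locale forked_vertex = low_excess_vertex +
  fixes w p q
  assumes pq: "par p w" "par q w" "p \<noteq> q"
begin

lemma forked_w: "forked w" using pq forkedI by blast

lemma d_z_w: "d z w = 2" using forked_level_eq_2 forked_w by blast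

lemma in_V: "w \<in> V" "p \<in> V" "q \<in> V"
  using pq par_in_V by blast+

lemma edges_pq: "E z p" "E z q" "E p w" "E q w" "E p q" "E p z" "E q z" "E w p" "E w q"
  using par_level_2[OF d_z_w] pq forked_parents_adjacent E_sym by blast+

lemma neighbours_w: "E w x \<Longrightarrow> x = p \<or> x = q \<or> d z x = 2"
  using level_cases[of w x] forked_two_parents[OF pq(1,2), of x] pq(3) d_z_w
    no_child_of_level_2[OF d_z_w] by auto

lemma distinct_vertices: "w \<noteq> z" "w \<noteq> p" "w \<noteq> q" "p \<noteq> z" "q \<noteq> z"
  using d_z_w d_self[OF z_in_V] edges_pq E_neq by auto

lemma ex_z_w: "2 \<le> ex z w"
  using ex_forked forked_w by blast

lemma d_values: "d w z = 2" "d w p = 1" "d w q = 1" "d w w = 0"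
  using d_z_w d_sym[of w z] edges_pq E_d d_self in_V by auto

section \<open>Charges of the first-sphere vertices other than the parents of the fork\<close>

context
  fixes x assumes x: "E z x" "x \<noteq> p" "x \<noteq> q"
begin

lemma x_basics: "x \<in> V" "E x z" "d x z = 1" "d x x = 0" "\<not> E w x" "x \<noteq> w"
proof -
  show "x \<in> V" "E x z" "d x z = 1" "d x x = 0" using x E_in_V E_sym E_d d_self by auto
  then have "d z x \<noteq> 2" by (simp add: d_sym)
  then show "\<not> E w x" "x \<noteq> w" using neighbours_w x d_z_w by auto
qed

lemma both_charge: "E x p \<Longrightarrow> E x q \<Longrightarrow> 2 \<le> ex x w"
  using ex_two_common_neighbours[of x w p q] x_basics edges_pq pq(3) E_commute[of x w] by auto

text \<open>Besides the path through \<open>p\<close>, the arc \<open>(q, z)\<close> separates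
  \<open>w\<close> from \<open>x\<close>; and \<open>x\<close> and \<open>q\<close> have the common
  neighbours \<open>z\<close> and \<open>p\<close>.\<close>

lemma one_charge:
  assumes "E x p" "\<not> E x q"
  shows "1 \<le> ex x w" "2 \<le> ex x q"
proof -
  have d: "d w x = 2" "d x q = 2" "d x p = 1" "d x w = 2"
    using d_2I[of w p x] d_2I[of x z q] x x_basics edges_pq assms E_sym E_d d_sym[of w x] by auto
  have "1 \<le> ex w x"
  proof (rule ex_ge_card)
    show "{(w, p), (p, x), (q, z)} \<subseteq> sep w x"
      using edges_pq d d_values x_basics E_sym[OF assms(1)] by (auto intro!: sepI)
    show "d w x + 1 \<le> card {(w, p), (p, x), (q, z)}"
      using d distinct_vertices pq(3) by auto
  qed (use in_V x_basics in auto)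
  then show "1 \<le> ex x w" by (simp add: ex_commute)
  show "2 \<le> ex x q"
    using ex_two_common_neighbours[of x q z p] x x_basics edges_pq assms distinct_vertices by auto
qed

text \<open>Here \<open>w\<close> is at distance 3 from \<open>x\<close>: a common neighbour would
  be a child of \<open>x\<close> next to \<open>w\<close>, making \<open>x\<close> a third parent of
  \<open>w\<close>. Both routes through \<open>p\<close> and \<open>q\<close> are then geodesic,
  which is two arcs more than needed.\<close>

lemma neither_charge:
  assumes "\<not> E x p" "\<not> E x q" shows "2 \<le> ex x w"
proof -
  have "3 \<le> d w x"
  proof (rule d_ge_3)
    fix u assume u: "E w u" "E u x"
    then have "d z u = 2" using neighbours_w assms E_sym by blast
    then have "par x u" using par_level_2 x u E_sym by blast
    then have "par x w" using forked_neighbour_parent[OF forked_w u(1)] \<open>d z u = 2\<close> d_z_w by simp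
    then show False using forked_two_parents[OF pq(1,2)] pq(3) x by blast
  qed (use in_V x_basics in auto)
  moreover have "d w x \<le> 3" using E_step[OF in_V(1) x(1)] d_values by simp
  ultimately have d: "d w x = 3" "d x w = 3" "d x p = 2" "d x q = 2"
    using d_2I[of x z p] d_2I[of x z q] x x_basics edges_pq assms d_sym[of x w] by auto
  have "2 \<le> ex w x"
  proof (rule ex_ge_card)
    show "{(w, p), (w, q), (p, z), (q, z), (z, x)} \<subseteq> sep w x"
      using edges_pq d d_values x_basics x by (auto intro!: sepI)
    show "d w x + 2 \<le> card {(w, p), (w, q), (p, z), (q, z), (z, x)}"
      using d distinct_vertices pq(3) by auto
  qed (use in_V x_basics in auto)
  then show ?thesis by (simp add: ex_commute)
qed

end

lemma forked_vertex_swap: "forked_vertex V E d z w q p"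
  using pq by unfold_locales auto

text \<open>Adjacency to both, neither or exactly one of \<open>p\<close>, \<open>q\<close> is
  distinguished; the last case gives the surplus unit used in the final count.\<close>

lemma charge:
  assumes "E z x" "x \<noteq> p" "x \<noteq> q"
  shows "2 \<le> ex x w + ex x p + ex x q"
    and "E x p \<noteq> E x q \<Longrightarrow> 3 \<le> ex x w + ex x p + ex x q"
proof -
  show *: "3 \<le> ex x w + ex x p + ex x q" if "E x p \<noteq> E x q"
    using one_charge[OF assms] forked_vertex.one_charge[OF forked_vertex_swap assms(1,3,2)] that
    by fastforce
  show "2 \<le> ex x w + ex x p + ex x q"
    using * both_charge[OF assms] neither_charge[OF assms] by fastforce
qed

text \<open>\<open>b\<close> is not a second fork, so it misses a parent \<open>r\<close> of
  \<open>w\<close>, and the arc \<open>(r, w)\<close> separates \<open>z\<close> from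
  \<open>b\<close>.\<close>

lemma level_2_adjacent_forked:
  assumes "E b w" "d z b = 2" shows "1 \<le> ex z b"
proof -
  have bw: "b \<noteq> w" "b \<in> V" using assms E_neq E_in_V by auto
  then have "\<not> forked b" using forked_unique forked_w by blast
  then obtain r where r: "par r w" "\<not> par r b" using forkedI pq by blast
  then have "\<not> E r b" using d_z_w assms(2) by (auto simp: par_def)
  then show ?thesis
    using ex_ge_1[OF bw(2)] horizontal_sep[of w b r] r(1) assms d_z_w E_commute[of w b] by auto
qed

text \<open>Delete \<open>a\<close> and follow an edge leaving the set of its children other than
  \<open>w\<close>. That edge is horizontal, and since cross edges avoiding \<open>w\<close> do not
  exist, it must end in \<open>w\<close>.\<close>

lemma level_2_parent:
  assumes "s \<noteq> w" "d z s = 2" "par a s"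
  shows "\<exists>b. b \<noteq> w \<and> E b w \<and> d z b = 2 \<and> par a b \<and> par a w"
proof -
  have unf: "\<not> forked t" if "t \<noteq> w" for t using that forked_unique forked_w by blast
  let ?S = "{t. t \<noteq> w \<and> d z t = 2 \<and> par a t}"
  have az: "a \<noteq> z" "E z a" using assms par_level_2 E_neq by auto
  have "?S \<subseteq> V - {a}" using par_in_V par_E E_neq by blast
  moreover have "?S \<noteq> {}" using assms by blast
  moreover have "z \<in> V - {a}" "z \<notin> ?S" using az z_in_V d_self by auto
  ultimately obtain t u where tu: "t \<in> ?S" "u \<notin> ?S" "u \<noteq> a" "E t u"
    using cut[of a ?S z] par_in_V(1)[OF assms(3)] by blast
  have "\<not> par u t" using forkedI[of u t a] tu unf by blast
  moreover have "\<not> par t u" using no_child_of_level_2 tu by blast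
  ultimately have lu: "d z u = d z t" using level_cases[OF tu(4)] by simp
  have "u = w"
  proof (rule ccontr)
    assume "u \<noteq> w"
    then have "par a u"
      using same_parent[OF tu(4) lu[symmetric]] tu unf forked_not_cross[OF forked_w] by blast
    then show False using tu lu \<open>u \<noteq> w\<close> by auto
  qed
  moreover have "par a w"
    using forked_neighbour_parent[OF forked_w, of t a] tu lu E_sym[OF tu(4)] \<open>u = w\<close> by simp
  ultimately show ?thesis using tu by blast
qed

text \<open>The second sphere contains more than \<open>w\<close>. By the budget \<open>b\<close> is
  the only neighbour of \<open>w\<close> there, which forces \<open>p\<close> to be a parent of
  every vertex of the second sphere; so the fan argument with hub \<open>p\<close> and root
  \<open>w\<close> applies.\<close>

lemma sum_ex_ge_nonempty:
  assumes b: "b \<noteq> w" "E b w" "d z b = 2" "par p b"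
  shows "4 * card V \<le> (\<Sum>x\<in>V. \<Sum>y\<in>V. ex x y) + 10"
proof -
  let ?B = "{x \<in> V. d z x = 2}"
  have unf: "\<not> forked t" if "t \<noteq> w" for t using that forked_unique forked_w by blast
  have bV: "b \<in> V" using b E_in_V by blast
  have uniq: "c = b" if "E c w" "d z c = 2" for c
  proof (rule ccontr)
    assume "c \<noteq> b"
    moreover have "c \<noteq> w" "c \<in> V" using that E_neq E_in_V by auto
    ultimately show False
      using level_2_adjacent_forked[OF that] level_2_adjacent_forked[OF b(2,3)] ex_z_w
        ex_sum3[of c b w] bV in_V b by auto
  qed
  have parp: "par p s" if s: "s \<in> ?B" for s
  proof (cases "s = w")
    case False
    have "s \<noteq> z" using s d_self z_in_V by auto
    then obtain a where a: "par a s" using par_exists s by blast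
    then have "par a b" using level_2_parent[OF False _ a] uniq s by blast
    then have "a = p" using forkedI[of a b p] unf b by blast
    then show ?thesis using a by simp
  qed (simp add: pq)
  have conn: "\<exists>s\<in>X. \<exists>t\<in>?B - X. E s t" if X: "X \<subseteq> ?B - {w}" "X \<noteq> {}" for X
  proof -
    have "z \<notin> X" using X d_self z_in_V by auto
    moreover have "X \<subseteq> V - {p}" using X parp par_E E_neq by blast
    ultimately obtain s t where st: "s \<in> X" "t \<notin> X" "t \<noteq> p" "E s t"
      using cut[of p X z] X(2) in_V z_in_V distinct_vertices by blast
    have s: "s \<in> ?B" "s \<noteq> w" using st X by auto
    have "\<not> par t s" using forkedI[of t s p] parp s st unf by blast
    moreover have "\<not> par s t" using no_child_of_level_2 s by blast
    ultimately have "t \<in> ?B" using level_cases[OF st(4)] s E_in_V[OF st(4)] by simp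
    then show ?thesis using st by blast
  qed
  have "w \<in> ?B" using in_V d_z_w by blast
  then have "\<exists>f (\<rho> :: 'a \<Rightarrow> nat). \<forall>s\<in>?B - {w}. \<not> E s w
      \<longrightarrow> f s \<in> ?B \<and> \<rho> (f s) < \<rho> s \<and> 2 \<le> ex s (f s)"
    by (rule fan_charge) (fact par_E[OF parp], fact conn)
  then obtain f and \<rho> :: "'a \<Rightarrow> nat" where "\<forall>s\<in>?B - {w}. \<not> E s w
      \<longrightarrow> f s \<in> ?B \<and> \<rho> (f s) < \<rho> s \<and> 2 \<le> ex s (f s)" by (elim exE)
  then have f: "f s \<in> ?B \<and> \<rho> (f s) < \<rho> s \<and> 2 \<le> ex s (f s)" if "s \<in> ?B" "s \<noteq> w" "\<not> E s w" for s
    using that by blast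
  \<comment> \<open>The exceptional set is \<open>{z, w, p, q}\<close>: its three units come from
    \<open>z\<close> with \<open>w\<close> and \<open>b\<close>. The ranks below place the partners
    \<open>w\<close>, \<open>p\<close>, \<open>q\<close>, \<open>b\<close> under all vertices that
    charge them.\<close>
  define M where "M x = (if x = w \<or> x = p \<or> x = q then {} else if x = b then {q} else if x = z then {w, b}
    else if E z x then {w, p, q} else {f x})" for x
  define r where "r x = (if x = w \<or> x = p \<or> x = q then 0 else if x = b then 1 else if x = z then 2
    else 3 + \<rho> x)" for x
  have nE: "\<not> E z x" if "d z x = 2" for x using that E_d by fastforce
  have bne: "b \<noteq> z" "b \<noteq> p" "b \<noteq> q" using nE b edges_pq d_self[OF z_in_V] by auto
  have rest: "x \<in> ?B \<and> \<not> E x w" if "x \<in> V" "x \<noteq> w" "x \<noteq> z" "\<not> E z x" "x \<noteq> b" for x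
    using vertex_cases[OF that(1)] that uniq by blast
  show ?thesis
  proof (rule sum_ex_charge_ge[of M r "{z, w, p, q}"])
    show "M x \<subseteq> V" if "x \<in> V" for x
      using that in_V bV f[of x] rest[of x] by (auto simp: M_def)
    show "r y < r x" if "x \<in> V" "y \<in> M x" for x y
      using that f[of x] rest[of x] bne distinct_vertices b by (auto simp: M_def r_def split: if_splits)
    show "{z, w, p, q} \<subseteq> V" "card {z, w, p, q} = 4" using in_V z_in_V distinct_vertices pq by auto
    show "3 \<le> (\<Sum>x\<in>{z, w, p, q}. \<Sum>y\<in>M x. ex x y)"
      using ex_z_w level_2_adjacent_forked[OF b(2,3)] distinct_vertices pq bne b by (simp add: M_def)
    show "2 \<le> (\<Sum>y\<in>M x. ex x y)" if x: "x \<in> V - {z, w, p, q}" for x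
    proof (cases "x = b")
      case True
      \<comment> \<open>Adjacency to \<open>q\<close> would make \<open>b\<close> a second fork;
        hence \<open>p\<close> and \<open>w\<close> are common neighbours of a nonadjacent
        pair.\<close>
      have "\<not> E b q" using forkedI[of p b q] unf b pq par_level_2[OF b(3)] edges_pq E_commute[of b q] by blast
      then have "2 \<le> ex b q"
        using ex_two_common_neighbours[of b q p w] bne distinct_vertices edges_pq b par_E E_sym by blast
      then show ?thesis using True x by (simp add: M_def)
    next
      case False
      then show ?thesis using x f[of x] rest[of x] charge(1)[of x] distinct_vertices pq
        by (auto simp: M_def)
    qed
  qed
qed

text \<open>With \<open>w\<close> alone in the second sphere, one first-sphere vertex
  \<open>x0\<close> has to supply three units. Its rank lies above that of the other vertices
  charged by \<open>{w, p, q}\<close>, so it may use pairs with further vertices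
  \<open>Y\<close>.\<close>

lemma sum_ex_ge_only:
  assumes only: "\<And>x. d z x = 2 \<Longrightarrow> x \<in> V \<Longrightarrow> x = w"
    and x0: "E z x0" "x0 \<noteq> p" "x0 \<noteq> q" and Y: "\<And>y. y \<in> Y \<Longrightarrow> E z y \<and> y \<noteq> p \<and> y \<noteq> q \<and> y \<noteq> x0"
    and big: "3 \<le> (\<Sum>y\<in>{w, p, q} \<union> Y. ex x0 y)"
  shows "4 * card V \<le> (\<Sum>x\<in>V. \<Sum>y\<in>V. ex x y) + 10"
proof -
  define M where "M x = (if x = w \<or> x = p \<or> x = q then {} else if x = z then {w}
    else if x = x0 then {w, p, q} \<union> Y else {w, p, q})" for x
  define r where "r x = (if x = w \<or> x = p \<or> x = q then 0 else if x = x0 then 2 else 1 :: nat)" for x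
  have YV: "Y \<subseteq> V" using Y E_in_V by blast
  have ne: "x0 \<in> V" "x0 \<noteq> z" "x0 \<noteq> w" "w \<notin> Y" "z \<notin> Y"
    using x_basics[OF x0] E_neq Y x_basics(6) by auto
  show ?thesis
  proof (rule sum_ex_charge_ge[of M r "{x0, w, p, q}"])
    show "M x \<subseteq> V" if "x \<in> V" for x using in_V YV by (auto simp: M_def)
    show "r y < r x" if "x \<in> V" "y \<in> M x" for x y
      using that Y ne distinct_vertices x0 by (auto simp: M_def r_def split: if_splits)
    show "{x0, w, p, q} \<subseteq> V" "card {x0, w, p, q} = 4" using in_V ne x0 distinct_vertices pq by auto
    show "3 \<le> (\<Sum>x\<in>{x0, w, p, q}. \<Sum>y\<in>M x. ex x y)"
      using big ne x0 distinct_vertices pq by (simp add: M_def)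
    show "2 \<le> (\<Sum>y\<in>M x. ex x y)" if x: "x \<in> V - {x0, w, p, q}" for x
    proof (cases "x = z")
      case True
      then show ?thesis using ex_z_w distinct_vertices by (simp add: M_def)
    next
      case False
      then have "E z x" using vertex_cases[of x] x only by blast
      then show ?thesis using charge(1)[of x] x False distinct_vertices pq by (simp add: M_def)
    qed
  qed
qed

text \<open>The assumption says that \<open>w\<close> with neighbours \<open>p\<close>,
  \<open>q\<close> does not exhibit the graph as a clique plus a vertex of degree two. If the second
  sphere is only \<open>w\<close>, its neighbours are exactly \<open>p\<close> and \<open>q\<close>,
  so an edge is missing among the others.\<close>

lemma sum_ex_ge:
  assumes "\<not> (\<forall>x\<in>V - {w}. \<forall>y\<in>V - {w}. x \<noteq> y \<longrightarrow> E x y)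
    \<or> \<not> (\<forall>x. E w x \<longleftrightarrow> x = p \<or> x = q)"
  shows "4 * card V \<le> (\<Sum>x\<in>V. \<Sum>y\<in>V. ex x y) + 10"
proof (cases "\<exists>s\<in>V. s \<noteq> w \<and> d z s = 2")
  case True
  then obtain s where s: "s \<in> V" "s \<noteq> w" "d z s = 2" by blast
  then have "s \<noteq> z" using d_self z_in_V by auto
  then obtain a where "par a s" using par_exists s by blast
  then obtain b where b: "b \<noteq> w" "E b w" "d z b = 2" "par a b" "par a w" using level_2_parent s by blast
  then have "a = p \<or> a = q" using forked_two_parents[OF pq(1,2)] pq(3) by blast
  then show ?thesis
    using sum_ex_ge_nonempty[of b] forked_vertex.sum_ex_ge_nonempty[OF forked_vertex_swap, of b] b by blast
next
  case False
  then have only: "x = w" if "d z x = 2" "x \<in> V" for x using that by blast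
  have Nw: "E w x \<longleftrightarrow> x = p \<or> x = q" for x
    using neighbours_w[of x] edges_pq only[of x] E_in_V[of w x] E_irrefl by blast
  then obtain x y where xy: "x \<in> V" "y \<in> V" "x \<noteq> w" "y \<noteq> w" "x \<noteq> y" "\<not> E x y"
    using assms by blast
  have adjz: "E z v" if "v \<in> V" "v \<noteq> w" "v \<noteq> z" for v using vertex_cases[OF that(1)] only that by blast
  have xyz: "E z x" "E z y" using adjz[of x] adjz[of y] xy E_commute[of x] by blast+
  \<comment> \<open>Three ways to find \<open>x0\<close>: a vertex adjacent to exactly one of
    \<open>p\<close>, \<open>q\<close>; a vertex adjacent to neither that has a neighbour
    \<open>t\<close> other than \<open>z\<close> adjacent to both; or an end of the missing edge,
    with the other end as \<open>Y\<close>.\<close>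
  consider u where "E z u" "u \<noteq> p" "u \<noteq> q" "E u p \<noteq> E u q"
    | u where "E z u" "u \<noteq> p" "u \<noteq> q" "\<not> E u p" "\<not> E u q"
        "\<And>v. E z v \<Longrightarrow> v \<noteq> p \<Longrightarrow> v \<noteq> q \<Longrightarrow> E v p \<longleftrightarrow> E v q"
    | "\<And>v. E z v \<Longrightarrow> v \<noteq> p \<Longrightarrow> v \<noteq> q \<Longrightarrow> E v p \<and> E v q" by metis
  then show ?thesis
  proof cases
    case 1
    have "3 \<le> (\<Sum>v\<in>{w, p, q} \<union> {}. ex u v)"
      using charge(2)[OF 1] distinct_vertices pq by simp
    then show ?thesis by (intro sum_ex_ge_only[OF only 1(1-3), of "{}"]) auto
  next
    case 2
    let ?S = "{v. E z v \<and> v \<noteq> p \<and> v \<noteq> q \<and> \<not> E v p \<and> \<not> E v q}"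
    have "?S \<subseteq> V - {z}" using E_in_V E_neq by blast
    moreover have "?S \<noteq> {}" using 2 by blast
    ultimately obtain s t where st: "s \<in> ?S" "t \<notin> ?S" "t \<noteq> z" "E s t"
      using cut[of z ?S p] z_in_V in_V distinct_vertices by blast
    have t: "t \<noteq> w" "t \<noteq> p" "t \<noteq> q" "t \<in> V" using st Nw[of s] E_commute[of s w] E_in_V by auto
    then have Et: "E z t" "E t p" "E t q" using adjz[of t] st 2(6)[of t] by blast+
    have "2 \<le> ex s p" "2 \<le> ex s q"
      using ex_two_common_neighbours[of s p z t] ex_two_common_neighbours[of s q z t] st Et edges_pq
        E_sym[of z s] by auto
    then have "3 \<le> (\<Sum>v\<in>{w, p, q} \<union> {}. ex s v)" using distinct_vertices pq by simp
    then show ?thesis using st by (intro sum_ex_ge_only[OF only, of s "{}"]) auto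
  next
    case 3
    have npq: "x \<noteq> p" "x \<noteq> q" "y \<noteq> p" "y \<noteq> q"
      using 3[of x] 3[of y] xy xyz edges_pq(5) E_commute[of x y] E_commute[of p q] by auto
    have "2 \<le> ex x w" using both_charge[of x] xyz npq 3[of x] by blast
    moreover have "2 \<le> ex x y"
      using ex_two_common_neighbours[of x y z p] xy xyz 3[OF xyz(1)] 3[OF xyz(2)] npq distinct_vertices
        E_commute[of x z] E_commute[of p y] by auto
    moreover have "(\<Sum>v\<in>{w, p, q} \<union> {y}. ex x v) = ex x w + ex x p + ex x q + ex x y"
      using distinct_vertices pq npq xy by simp
    ultimately have "3 \<le> (\<Sum>v\<in>{w, p, q} \<union> {y}. ex x v)" by simp
    then show ?thesis using xyz npq xy by (intro sum_ex_ge_only[OF only, of x "{y}"]) auto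
  qed
qed

end

section \<open>An edge between two branches\<close>

text \<open>The configuration is the five-cycle \<open>z\<close>, \<open>a\<close>,
  \<open>b\<close>, \<open>b'\<close>, \<open>a'\<close>, symmetric under exchanging the primed and
  unprimed vertices; \<open>swap\<close> transfers every fact to the other side.\<close>

locale cross_edge = low_excess_vertex +
  fixes a b a' b'
  assumes unforked: "\<not> forked y"
    and pa: "par a b" "par a' b'" and cr: "cross b b'"
begin

lemma swap: "cross_edge V E d z a' b' a b"
  using unforked pa cross_sym[OF cr] by unfold_locales auto

lemma par_unique: "par x y \<Longrightarrow> par x' y \<Longrightarrow> x = x'"
  using forkedI unforked by blast

lemma in_V: "a \<in> V" "a' \<in> V" "b \<in> V" "b' \<in> V"
  using pa par_in_V by blast+

lemma neq_parents: "a \<noteq> a'"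
  using cr pa by (auto simp: cross_def)

lemma level_b: "d z b = 2"
proof -
  have "d z b \<noteq> 1"
  proof
    assume "d z b = 1"
    then have "E z b" "E z b'" using level_1_iff in_V cr by (auto simp: cross_def)
    then have "par z b" "par z b'" by (simp_all add: par_z_iff)
    then show False using cr by (auto simp: cross_def)
  qed
  moreover have "d z b \<noteq> 0" using par_d[OF pa(1)] by simp
  ultimately show ?thesis using level_le_2[OF in_V(3)] by linarith
qed

lemma level_b': "d z b' = 2"
  using level_b cr by (simp add: cross_def)

text \<open>Disjoint cross edges put excess on four vertices. If two share an end, that end has
  excess 2 and the other two ends 1 each. Either way the total is 4.\<close>

lemma cross_edge_unique:
  assumes "cross s t" shows "s = b \<and> t = b' \<or> s = b' \<and> t = b"
proof -
  have share: "t = u" if "cross s t" "cross s u" for s t u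
  proof (rule ccontr)
    assume tu: "t \<noteq> u"
    have V: "s \<in> V" "t \<in> V" "u \<in> V" using that cross_in_V by blast+
    have "t \<noteq> z" "u \<noteq> z" using that cross_sym cross_neq_z by blast+
    then obtain ct cu where c: "par ct t" "par cu u" using par_exists V by blast
    have "2 \<le> ex z s"
      using ex_ge_2[OF V(1), of "(ct, t)" "(cu, u)"] cross_sep cross_sym that c tu by blast
    moreover have "1 \<le> ex z t" "1 \<le> ex z u" using that cross_ex by blast+
    moreover have "s \<noteq> t" "s \<noteq> u" using that E_neq by (auto simp: cross_def)
    ultimately show False using ex_sum3[OF V] tu by simp
  qed
  have ne: "s \<noteq> t" "b \<noteq> b'" using assms cr E_neq by (auto simp: cross_def)
  have "\<not> distinct [s, t, b, b']"
    using ex_sum4[of s t b b'] cross_in_V[OF assms] in_V cross_ex[OF assms] cross_ex[OF cr]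
      cross_ex[OF cross_sym[OF assms]] cross_ex[OF cross_sym[OF cr]] by linarith
  then show ?thesis
    using ne share assms cr cross_sym[OF assms] cross_sym[OF cr] by auto
qed

lemma edges_ab: "E z a" "E z a'" "E a z" "E a' z" "E a b" "E a' b'" "E b a" "E b' a'" "E b b'" "E b' b"
  using par_level_2[OF level_b, of a] par_level_2[OF level_b', of a'] pa cr E_sym
  by (auto simp: cross_def)

lemma distinct_vertices: "z \<noteq> a" "z \<noteq> a'" "z \<noteq> b" "z \<noteq> b'" "a \<noteq> b" "a \<noteq> b'" "a' \<noteq> b" "a' \<noteq> b'" "b \<noteq> b'"
proof -
  have "d z z = 0" "d z a = 1" "d z a' = 1" using edges_ab E_d d_self z_in_V by auto
  then show "z \<noteq> a" "z \<noteq> a'" "z \<noteq> b" "z \<noteq> b'" "a \<noteq> b" "a \<noteq> b'" "a' \<noteq> b" "a' \<noteq> b'"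
    using level_b level_b' by auto
qed (use edges_ab E_neq in blast)

text \<open>The descendants of any such parent \<open>c\<close> are left by a cross edge, hence by
  the one between \<open>b\<close> and \<open>b'\<close>, so \<open>c\<close> is the parent of one
  of its ends.\<close>

lemma parent_cases:
  assumes "d z s = 2" "par c s" shows "c = a \<or> c = a'"
proof -
  have c: "c \<in> V" "c \<noteq> z" "d z c = 1"
    using assms par_in_V par_d[OF assms(2)] d_self[OF z_in_V] by auto
  have "s \<in> desc c" using desc_child[OF c(1) _ assms(2)] by blast
  then obtain s1 t1 where st: "s1 \<in> desc c" "cross s1 t1" using unforked_escape[OF c(1,2)] unforked by blast
  obtain x where x: "x \<in> insert c (desc c)" "par x s1" using desc_parent[OF c(1) st(1)] by blast
  have "x = c"
  proof (rule ccontr)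
    assume "x \<noteq> c"
    then have "d z x \<ge> 2" using x desc_level[OF c(1), of x] c by auto
    then have "d z x = 2" using level_le_2[of x] par_in_V x by force
    then show False using no_child_of_level_2 x by blast
  qed
  moreover have "s1 = b \<or> s1 = b'" using cross_edge_unique[OF st(2)] by blast
  ultimately show ?thesis using par_unique x(2) pa by blast
qed

text \<open>An edge from a child of \<open>a\<close> goes up to its only parent, stays among the
  children of \<open>a\<close>, or is the cross edge.\<close>

lemma neighbours_level_2:
  assumes "par a s" "E s t" "d z a = 1"
  shows "t = a \<or> par a t \<or> s = b \<and> t = b'"
proof -
  have s2: "d z s = 2" using assms par_d by fastforce
  consider "par t s" | "d z s = d z t" using level_cases[OF assms(2)] no_child_of_level_2[OF s2] by blast
  then show ?thesis
  proof cases
    case 2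
    then have "par a t \<or> cross s t" using same_parent[OF assms(2) 2 assms(1)] unforked by blast
    moreover have "s \<noteq> b'" using assms(1) pa(2) par_unique neq_parents by blast
    ultimately show ?thesis using cross_edge_unique by blast
  qed (use par_unique assms in blast)
qed

section \<open>Distances and excesses around the five-cycle\<close>

lemma d_ab: "d z a = 1" "d z a' = 1" "d a b = 1" "d a' b' = 1" "d b a = 1" "d b' a' = 1" "d a z = 1" "d a' z = 1"
  "d b b' = 1" "d b' b = 1" "d b z = 2" "d b' z = 2"
  using edges_ab E_d level_b level_b' d_sym[of b z] d_sym[of b' z] by auto

lemma d_self_ab: "d z z = 0" "d a a = 0" "d a' a' = 0" "d b b = 0" "d b' b' = 0"
  using d_self in_V z_in_V by auto

lemma not_E: "\<not> E a b'" "\<not> E b' a" "\<not> E a' b" "\<not> E b a'"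
  using par_level_2[OF level_b', of a] par_level_2[OF level_b, of a'] par_unique pa neq_parents
    edges_ab E_commute by blast+

lemma d_across: "d a b' = 2" "d b' a = 2" "d a' b = 2" "d b a' = 2"
  using d_2I[of a b b'] d_2I[of b' b a] d_2I[of a' b' b] d_2I[of b b' a'] not_E edges_ab distinct_vertices
  by auto

lemmas ab = edges_ab d_ab d_self_ab d_across

lemma par_a_facts:
  assumes "par a s"
  shows "d z s = 2" "s \<in> V" "E a s" "E s a" "d a s = 1" "d s a = 1" "d s s = 0" "d s z = 2"
    "s \<noteq> z" "s \<noteq> a" "s \<noteq> a'" "s \<noteq> b'" "\<not> E s a'" "\<not> E s z" "\<not> par a' s" "\<not> E z s"
proof -
  show s2: "d z s = 2" and s: "s \<in> V" "E a s" "E s a" "d a s = 1" "d s a = 1" "d s s = 0" "d s z = 2"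
  proof -
    show s2: "d z s = 2" using par_d[OF assms] d_ab by simp
    show "s \<in> V" "E a s" "E s a" using par_in_V par_E E_sym assms by blast+
    then show "d a s = 1" "d s a = 1" "d s s = 0" using E_d d_self by auto
    show "d s z = 2" using s2 d_sym[of s z] by simp
  qed
  show "s \<noteq> z" "s \<noteq> a" "s \<noteq> a'" "\<not> E s z" "\<not> E z s" using s2 d_ab d_self_ab E_d[of z s] E_commute[of s z] by auto
  show np: "\<not> par a' s" using assms par_unique neq_parents by blast
  show "s \<noteq> b'" using np pa by blast
  show "\<not> E s a'" using np par_level_2[OF s2] edges_ab E_sym by blast
qed

text \<open>If \<open>a\<close> and \<open>a'\<close> are adjacent, both diagonals \<open>a\<close>,
  \<open>b'\<close> and \<open>a'\<close>, \<open>b\<close> have two common neighbours. Otherwise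
  each of the three pairs is also separated by the middle edge of the longer way round the
  cycle.\<close>

lemma hub_charge: "3 \<le> ex a b' + ex a a' + ex a' b"
proof (cases "E a a'")
  case True
  then have "2 \<le> ex a b'" "2 \<le> ex a' b"
    using ex_two_common_neighbours[of a b' a' b] ex_two_common_neighbours[of a' b a b'] edges_ab not_E
      distinct_vertices E_commute[of a' a] by auto
  then show ?thesis by simp
next
  case False
  then have d: "d a a' = 2" "d a' a = 2"
    using d_2I[of a z a'] edges_ab neq_parents d_sym[of a a'] by auto
  have "1 \<le> ex a b'"
  proof (rule ex_ge_card)
    show "{(a, b), (b, b'), (z, a')} \<subseteq> sep a b'" using ab d by (auto intro!: sepI)
    show "d a b' + 1 \<le> card {(a, b), (b, b'), (z, a')}" using d_across distinct_vertices neq_parents by auto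
  qed (use in_V in auto)
  moreover have "1 \<le> ex a' b"
  proof (rule ex_ge_card)
    show "{(a', b'), (b', b), (z, a)} \<subseteq> sep a' b" using ab d by (auto intro!: sepI)
    show "d a' b + 1 \<le> card {(a', b'), (b', b), (z, a)}" using d_across distinct_vertices neq_parents by auto
  qed (use in_V in auto)
  moreover have "1 \<le> ex a a'"
  proof (rule ex_ge_card)
    show "{(a, z), (z, a'), (b, b')} \<subseteq> sep a a'" using ab d by (auto intro!: sepI)
    show "d a a' + 1 \<le> card {(a, z), (z, a'), (b, b')}" using d distinct_vertices neq_parents by auto
  qed (use in_V in auto)
  ultimately show ?thesis by simp
qed

text \<open>Such an \<open>x\<close> has no children, since only \<open>a\<close> and
  \<open>a'\<close> do. Hence a common neighbour of \<open>x\<close> and \<open>b\<close> can only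
  be \<open>a\<close>.\<close>

lemma outer_far:
  assumes x: "E z x" "x \<noteq> a" "x \<noteq> a'"
  shows "\<not> E x b" "\<not> E x b'" "E x u \<Longrightarrow> E u b \<Longrightarrow> u = a" "x \<noteq> b" "x \<noteq> b'"
proof -
  have nochild: "\<not> E x y" if "d z y = 2" for y
    using parent_cases[OF that, of x] x par_level_2[OF that, of x] by blast
  then show "\<not> E x b" "\<not> E x b'" using level_b level_b' by blast+
  show "x \<noteq> b" "x \<noteq> b'" using x E_d[of z x] level_b level_b' by auto
  assume u: "E x u" "E u b"
  have "u = a \<or> par a u \<or> u = b'"
    using neighbours_level_2[OF pa(1) E_sym[OF u(2)] d_ab(1)] by blast
  then show "u = a" using nochild u(1) par_d[of a u] d_ab level_b' by fastforce
qed

text \<open>Seen from \<open>x\<close> the two branches look alike, so \<open>(a', b')\<close> leads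
  away from \<open>x\<close> as well as towards \<open>b\<close> and is off the geodesic chosen
  through \<open>a\<close>.\<close>

lemma outer_charge_1:
  assumes x: "E z x" "x \<noteq> a" "x \<noteq> a'" and eq: "E x a \<longleftrightarrow> E x a'"
  shows "1 \<le> ex x b"
proof -
  interpret S: cross_edge V E d z a' b' a b by (rule swap)
  have xV: "x \<in> V" "E x z" "d x z = 1" "d x x = 0" "x \<noteq> z"
    using E_in_V[OF x(1)] E_sym[OF x(1)] E_d[OF E_sym[OF x(1)]] d_self[of x] E_neq[OF x(1)] by auto
  note far = outer_far[OF x] S.outer_far[OF x(1,3,2)]
  show ?thesis
  proof (cases "E x a")
    case True
    then have d: "d x a = 1" "d x a' = 1" "d x b = 2" "d x b' = 2" "d b x = 2"
      using eq E_d[of x a] E_d[of x a'] d_2I[of x a b] d_2I[of x a' b'] far(1,2,4,5) edges_ab d_sym[of b x] by auto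
    show ?thesis
    proof (rule ex_ge_card)
      show "{(x, a), (a, b), (a', b')} \<subseteq> sep x b" using ab d xV True by (auto intro!: sepI)
      show "d x b + 1 \<le> card {(x, a), (a, b), (a', b')}" using d x neq_parents by auto
    qed (use xV in_V in auto)
  next
    case False
    then have d2: "d x a = 2" "d x a' = 2" using eq x d_2I[of x z a] d_2I[of x z a'] xV edges_ab by auto
    have "3 \<le> d x b" "3 \<le> d x b'"
      using d_ge_3[of x b] d_ge_3[of x b'] far(1,2,4,5) far(3)[of _] far(8) xV(1) in_V False eq by blast+
    moreover have "d x b \<le> 3" "d x b' \<le> 3"
      using E_step[OF xV(1) edges_ab(5)] E_step[OF xV(1) edges_ab(6)] d2 by auto
    ultimately have d: "d x b = 3" "d x b' = 3" "d b x = 3" by (auto simp: d_sym[of b x])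
    show ?thesis
    proof (rule ex_ge_card)
      show "{(x, z), (z, a), (a, b), (a', b')} \<subseteq> sep x b" using ab d d2 xV by (auto intro!: sepI)
      show "d x b + 1 \<le> card {(x, z), (z, a), (a, b), (a', b')}"
        using d x xV neq_parents distinct_vertices by auto
    qed (use xV in_V in auto)
  qed
qed

text \<open>\<open>b'\<close> is at distance 3 both through \<open>a\<close>, \<open>b\<close> and
  through \<open>z\<close>, \<open>a'\<close>: two arc-disjoint geodesics, six arcs.\<close>

lemma outer_charge_3:
  assumes x: "E z x" "x \<noteq> a" "x \<noteq> a'" and ne: "E x a" "\<not> E x a'"
  shows "3 \<le> ex x b'"
proof -
  interpret S: cross_edge V E d z a' b' a b by (rule swap)
  have xV: "x \<in> V" "E x z" "d x z = 1" "d x x = 0" "x \<noteq> z" "d x a = 1"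
    using E_in_V[OF x(1)] E_sym[OF x(1)] E_d[OF E_sym[OF x(1)]] d_self[of x] E_neq[OF x(1)] E_d[OF ne(1)] by auto
  note far = outer_far[OF x] S.outer_far[OF x(1,3,2)]
  have d2: "d x a' = 2" "d x b = 2" using d_2I[of x z a'] d_2I[of x a b] far(1,4) xV edges_ab ne x by auto
  have "3 \<le> d x b'" using d_ge_3[of x b'] far(2,5,8) xV(1) in_V ne by blast
  moreover have "d x b' \<le> 3" using E_step[OF xV(1) edges_ab(6)] d2 by auto
  ultimately have d: "d x b' = 3" "d b' x = 3" by (auto simp: d_sym[of b' x])
  show ?thesis
  proof (rule ex_ge_card)
    show "{(x, a), (a, b), (b, b'), (x, z), (z, a'), (a', b')} \<subseteq> sep x b'"
      using ab d d2 xV ne by (auto intro!: sepI)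
    show "d x b' + 3 \<le> card {(x, a), (a, b), (b, b'), (x, z), (z, a'), (a', b')}"
      using d x xV far neq_parents distinct_vertices by auto
  qed (use xV in_V in auto)
qed

lemma outer_charge:
  assumes x: "E z x" "x \<noteq> a" "x \<noteq> a'"
  shows "2 \<le> ex x b + ex x b'"
  using outer_charge_1[OF x] outer_charge_3[OF x] cross_edge.outer_charge_1[OF swap x(1,3,2)]
    cross_edge.outer_charge_3[OF swap x(1,3,2)] by fastforce

text \<open>If \<open>a\<close> and \<open>a'\<close> are adjacent, the extra arcs are
  \<open>(a, a')\<close> for the pair with \<open>b'\<close> and \<open>(b, b')\<close> for the pair
  with \<open>a'\<close>. Otherwise \<open>a'\<close> is at distance at least 3 from
  \<open>s\<close>, and \<open>(z, a')\<close> and \<open>(b', a')\<close> serve for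
  \<open>b'\<close> and \<open>z\<close>.\<close>

lemma near_charge:
  assumes s: "par a s" "s \<noteq> b" "E s b"
  shows "2 \<le> ex s b' + ex s a' + ex s z"
proof -
  interpret S: cross_edge V E d z a' b' a b by (rule swap)
  note f = par_a_facts[OF s(1)]
  have nb: "\<not> E s b'" using neighbours_level_2[OF s(1) _ d_ab(1), of b'] s distinct_vertices par_a_facts(12)[of b'] by blast
  have db: "d s b = 1" "d s b' = 2" "d b' s = 2" using s E_d d_2I[of s b b'] nb f edges_ab d_sym[of b' s] by auto
  show ?thesis
  proof (cases "E a a'")
    case True
    then have d: "d a a' = 1" "d a' a = 1" "d s a' = 2" "d a' s = 2"
      using E_d E_sym[OF True] d_2I[of s a a'] f d_sym[of a' s] by auto
    have "1 \<le> ex s b'"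
    proof (rule ex_ge_card)
      show "{(s, b), (b, b'), (a, a')} \<subseteq> sep s b'" using ab d db s f True by (auto intro!: sepI)
      show "d s b' + 1 \<le> card {(s, b), (b, b'), (a, a')}" using db s f distinct_vertices by auto
    qed (use f in_V in auto)
    moreover have "1 \<le> ex s a'"
    proof (rule ex_ge_card)
      show "{(s, a), (a, a'), (b, b')} \<subseteq> sep s a'" using ab d db s f True by (auto intro!: sepI)
      show "d s a' + 1 \<le> card {(s, a), (a, a'), (b, b')}" using d s f distinct_vertices by auto
    qed (use f in_V in auto)
    ultimately show ?thesis by simp
  next
    case False
    have "3 \<le> d s a'"
    proof (rule d_ge_3)
      fix u assume u: "E s u" "E u a'"
      then have "u = a \<or> par a u" using neighbours_level_2[OF s(1) u(1) d_ab(1)] s by blast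
      then show False using False u par_a_facts(13)[of u] by blast
    qed (use f in_V in auto)
    then have d: "3 \<le> d s a'" "3 \<le> d a' s" by (auto simp: d_sym[of a' s])
    have "1 \<le> ex s b'"
    proof (rule ex_ge_card)
      show "{(s, b), (b, b'), (z, a')} \<subseteq> sep s b'" using ab d db s f by (auto intro!: sepI)
      show "d s b' + 1 \<le> card {(s, b), (b, b'), (z, a')}" using db s f distinct_vertices by auto
    qed (use f in_V in auto)
    moreover have "1 \<le> ex s z"
    proof (rule ex_ge_card)
      show "{(s, a), (a, z), (b', a')} \<subseteq> sep s z" using ab level_b' d db s f by (auto intro!: sepI)
      show "d s z + 1 \<le> card {(s, a), (a, z), (b', a')}" using f distinct_vertices by auto
    qed (use f in_V z_in_V in auto)
    ultimately show ?thesis by simp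
  qed
qed

text \<open>The fan argument with hub \<open>a\<close> and root \<open>b\<close>. A set of children
  of \<open>a\<close> without \<open>b\<close> is left, after deletion of \<open>a\<close>, only by
  an edge to another child of \<open>a\<close>.\<close>

lemma branch_charge:
  obtains f and \<rho> :: "'a \<Rightarrow> nat"
  where "\<And>s. par a s \<Longrightarrow> s \<noteq> b \<Longrightarrow> \<not> E s b \<Longrightarrow> par a (f s) \<and> \<rho> (f s) < \<rho> s \<and> 2 \<le> ex s (f s)"
proof -
  let ?T = "{s. par a s}"
  have conn: "\<exists>s\<in>X. \<exists>t\<in>?T - X. E s t" if X: "X \<subseteq> ?T - {b}" "X \<noteq> {}" for X
  proof -
    have "z \<notin> X" using X par_a_facts(9) by blast
    moreover have "X \<subseteq> V - {a}" using X par_a_facts(2,10) by blast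
    ultimately obtain s t where st: "s \<in> X" "t \<notin> X" "t \<noteq> a" "E s t"
      using cut[of a X z] X(2) in_V z_in_V distinct_vertices by blast
    then have "par a t" using neighbours_level_2[OF _ st(4) d_ab(1)] X by blast
    then show ?thesis using st by blast
  qed
  have "b \<in> ?T" "\<And>t. t \<in> ?T \<Longrightarrow> E a t" using par_E pa(1) by blast+
  then have "\<exists>f (\<rho> :: 'a \<Rightarrow> nat). \<forall>s\<in>?T - {b}. \<not> E s b
      \<longrightarrow> f s \<in> ?T \<and> \<rho> (f s) < \<rho> s \<and> 2 \<le> ex s (f s)"
    by (rule fan_charge) (assumption, fact conn)
  then obtain f and \<rho> :: "'a \<Rightarrow> nat" where "\<forall>s\<in>?T - {b}. \<not> E s b
      \<longrightarrow> f s \<in> ?T \<and> \<rho> (f s) < \<rho> s \<and> 2 \<le> ex s (f s)" by (elim exE)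
  then show thesis using that by blast
qed

lemma sum_ex_ge: "4 * card V \<le> (\<Sum>x\<in>V. \<Sum>y\<in>V. ex x y) + 10"
proof -
  interpret S: cross_edge V E d z a' b' a b by (rule swap)
  obtain f and \<rho> :: "'a \<Rightarrow> nat"
    where f: "\<And>s. par a s \<Longrightarrow> s \<noteq> b \<Longrightarrow> \<not> E s b \<Longrightarrow> par a (f s) \<and> \<rho> (f s) < \<rho> s \<and> 2 \<le> ex s (f s)"
    using branch_charge by blast
  obtain g and \<sigma> :: "'a \<Rightarrow> nat"
    where g: "\<And>s. par a' s \<Longrightarrow> s \<noteq> b' \<Longrightarrow> \<not> E s b' \<Longrightarrow> par a' (g s) \<and> \<sigma> (g s) < \<sigma> s \<and> 2 \<le> ex s (g s)"
    using S.branch_charge by blast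
  \<comment> \<open>The exceptional set is \<open>{a, a', b, b'}\<close>; its three pairs are those
    of \<open>hub_charge\<close>. Children adjacent to the root of their branch use the far side of
    the cycle and \<open>z\<close>, and the remaining ones use their fan partner.\<close>
  define M where "M x = (if x = b \<or> x = b' then {} else if x = a' then {b} else if x = a then {b', a'}
    else if x = z \<or> E z x then {b, b'}
    else if par a x then (if E x b then {b', a', z} else {f x})
    else (if E x b' then {b, a, z} else {g x}))" for x
  define r where "r x = (if x = b \<or> x = b' then 0 else if x = a' then 1 else if x = a then 2
    else if x = z \<or> E z x then 3 else if par a x then 4 + \<rho> x else 4 + \<sigma> x)" for x
  note F = par_a_facts S.par_a_facts
  note ne = distinct_vertices neq_parents
  have Mspec: "M b = {}" "M b' = {}" "M a' = {b}" "M a = {b', a'}" "M z = {b, b'}"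
    and rspec: "r b = 0" "r b' = 0" "r a' = 1" "r a = 2" "r z = 3"
    using ne by (auto simp: M_def r_def)
  have Mout: "M x = {b, b'}" "r x = 3" if "E z x" "x \<noteq> a" "x \<noteq> a'" for x
    using that outer_far[OF that] by (auto simp: M_def r_def)
  have Ma: "M x = (if E x b then {b', a', z} else {f x})" "r x = 4 + \<rho> x" if "par a x" "x \<noteq> b" for x
    using that F[of x] by (auto simp: M_def r_def)
  have Ma': "M x = (if E x b' then {b, a, z} else {g x})" "r x = 4 + \<sigma> x" if "par a' x" "x \<noteq> b'" for x
    using that F[of x] by (auto simp: M_def r_def)
  \<comment> \<open>Only an inequality holds, because a fan partner may be \<open>b\<close>, whose
    rank is 0.\<close>
  have rf: "r x \<le> 4 + \<rho> x" if "par a x" for x using that Ma[of x] rspec by fastforce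
  have rg: "r x \<le> 4 + \<sigma> x" if "par a' x" for x using that Ma'[of x] rspec by fastforce
  have cases: thesis if "x \<in> V" and "x \<in> {a, a', b, b'} \<Longrightarrow> thesis" "x = z \<Longrightarrow> thesis"
    "E z x \<Longrightarrow> x \<noteq> a \<Longrightarrow> x \<noteq> a' \<Longrightarrow> thesis" "par a x \<Longrightarrow> x \<noteq> b \<Longrightarrow> thesis" "par a' x \<Longrightarrow> x \<noteq> b' \<Longrightarrow> thesis"
    for x thesis
  proof (cases rule: vertex_cases[OF that(1)])
    case 3
    then obtain c where "par c x" using par_exists \<open>x \<in> V\<close> by blast
    then show ?thesis using parent_cases[OF 3(1)] that by blast
  qed (use that in blast)+
  show ?thesis
  proof (rule sum_ex_charge_ge[of M r "{a, a', b, b'}"])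
    show "M x \<subseteq> V" if "x \<in> V" for x
    proof (rule cases[OF that])
      assume "par a x" "x \<noteq> b"
      then show ?thesis using Ma[of x] f[of x] par_in_V(2)[of a "f x"] in_V z_in_V by auto
    next
      assume "par a' x" "x \<noteq> b'"
      then show ?thesis using Ma'[of x] g[of x] par_in_V(2)[of a' "g x"] in_V z_in_V by auto
    qed (use in_V Mspec Mout[of x] in auto)
    show "r y < r x" if "x \<in> V" "y \<in> M x" for x y
    proof (rule cases[OF that(1)])
      assume "par a x" "x \<noteq> b"
      then show ?thesis using that(2) Ma[of x] f[of x] rf[of "f x"] rspec by (auto split: if_splits)
    next
      assume "par a' x" "x \<noteq> b'"
      then show ?thesis using that(2) Ma'[of x] g[of x] rg[of "g x"] rspec by (auto split: if_splits)
    qed (use that(2) Mspec rspec Mout[of x] in auto)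
    show "{a, a', b, b'} \<subseteq> V" "card {a, a', b, b'} = 4" using in_V ne by auto
    show "3 \<le> (\<Sum>x\<in>{a, a', b, b'}. \<Sum>y\<in>M x. ex x y)"
      using hub_charge ne Mspec by simp
    show "2 \<le> (\<Sum>y\<in>M x. ex x y)" if x: "x \<in> V - {a, a', b, b'}" for x
    proof (rule cases[of x])
      assume "x = z"
      then show ?thesis using cross_ex[OF cr] cross_ex[OF cross_sym[OF cr]] Mspec ne by simp
    next
      assume "E z x" "x \<noteq> a" "x \<noteq> a'"
      then show ?thesis using outer_charge[of x] Mout[of x] ne by simp
    next
      assume p: "par a x" "x \<noteq> b"
      have "b' \<noteq> a'" "b' \<noteq> z" "a' \<noteq> z" using ne by auto
      then show ?thesis using near_charge[OF p] f[OF p] Ma(1)[OF p] by (cases "E x b") simp_all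
    next
      assume p: "par a' x" "x \<noteq> b'"
      have "b \<noteq> a" "b \<noteq> z" "a \<noteq> z" using ne by auto
      then show ?thesis using S.near_charge[OF p] g[OF p] Ma'(1)[OF p] by (cases "E x b'") simp_all
    qed (use x in auto)
  qed
qed

end

section \<open>Combining the forked and the unforked case\<close>

context low_excess_vertex
begin

lemma sum_ex_ge:
  assumes nonuniv: "x \<in> V" "x \<noteq> z" "\<not> E z x"
    and not_K2: "\<And>w p q. p \<noteq> q \<Longrightarrow> w \<in> V \<Longrightarrow> (\<And>x. E w x \<longleftrightarrow> x = p \<or> x = q)
      \<Longrightarrow> (\<And>x y. x \<in> V - {w} \<Longrightarrow> y \<in> V - {w} \<Longrightarrow> x \<noteq> y \<Longrightarrow> E x y) \<Longrightarrow> False"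
  shows "4 * card V \<le> (\<Sum>x\<in>V. \<Sum>y\<in>V. ex x y) + 10"
proof (cases "\<exists>w. forked w")
  case True
  then obtain w p q where "par p w" "par q w" "p \<noteq> q" by (auto simp: forked_def)
  then interpret forked_vertex V E d z w p q by unfold_locales
  show ?thesis using sum_ex_ge not_K2[OF pq(3) in_V(1)] by blast
next
  case False
  then have unf: "\<not> forked y" for y by blast
  have x2: "d z x = 2" using vertex_cases[OF nonuniv(1)] nonuniv by blast
  obtain a where a: "par a x" using par_exists nonuniv by blast
  have aV: "a \<in> V" "a \<noteq> z" using a par_in_V par_d[OF a] x2 d_self[OF z_in_V] by auto
  have "x \<in> desc a" using desc_child[OF aV(1) _ a] by blast
  then obtain b b' where cr: "cross b b'" using unforked_escape[OF aV] unf by blast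
  obtain p p' where "par p b" "par p' b'"
    using par_exists[OF cross_in_V(1)[OF cr] cross_neq_z[OF cr]]
      par_exists[OF cross_in_V(2)[OF cr] cross_neq_z[OF cross_sym[OF cr]]] by blast
  then interpret cross_edge V E d z p b p' b' using unf cr by unfold_locales
  show ?thesis by (rule sum_ex_ge)
qed

end

section \<open>The lower bound\<close>

context biconnected_metric
begin

text \<open>\<open>U\<close> is the set of universal vertices. If every vertex of \<open>W\<close>
  has total excess at least 4, the deficit is \<open>4 * card U\<close>. Two universal vertices fit
  into the allowance of 10, and more of them raise the excess of every nonadjacent pair.\<close>

lemma sum_ex_ge:
  assumes noncomplete: "x0 \<in> V" "y0 \<in> V" "x0 \<noteq> y0" "\<not> E x0 y0"
    and not_K2: "\<And>w p q. p \<noteq> q \<Longrightarrow> w \<in> V \<Longrightarrow> (\<And>x. E w x \<longleftrightarrow> x = p \<or> x = q)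
      \<Longrightarrow> (\<And>x y. x \<in> V - {w} \<Longrightarrow> y \<in> V - {w} \<Longrightarrow> x \<noteq> y \<Longrightarrow> E x y) \<Longrightarrow> False"
    and not_minus_edge: "\<not> (\<forall>x\<in>V. \<forall>y\<in>V. x \<noteq> y \<longrightarrow> {x, y} \<noteq> {x0, y0} \<longrightarrow> E x y)"
  shows "4 * card V \<le> (\<Sum>x\<in>V. \<Sum>y\<in>V. ex x y) + 10"
proof -
  define U where "U = {x \<in> V. \<forall>y\<in>V. y \<noteq> x \<longrightarrow> E x y}"
  define W where "W = V - U"
  let ?c = "\<lambda>x. \<Sum>y\<in>V. ex x y"
  have fin: "finite U" "finite W" using finite_V by (auto simp: U_def W_def)
  have UW: "U \<subseteq> V" "W \<subseteq> V" by (auto simp: U_def W_def)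
  have cardV: "card V = card W + card U"
    using card_Diff_subset[OF fin(1) UW(1)] card_mono[OF finite_V UW(1)] by (simp add: W_def)
  have sumW: "(\<Sum>x\<in>W. ?c x) \<le> (\<Sum>x\<in>V. ?c x)" using UW finite_V by (intro sum_mono2) auto
  have Wx: "\<exists>y\<in>V. y \<noteq> x \<and> \<not> E x y" if "x \<in> W" for x using that by (auto simp: W_def U_def)
  have xyW: "x0 \<in> W" "y0 \<in> W" using noncomplete E_commute[of y0 x0] by (auto simp: W_def U_def)
  show ?thesis
  proof (cases "\<exists>z\<in>W. ?c z \<le> 3")
    case True
    then obtain z where z: "z \<in> W" "?c z \<le> 3" by blast
    then interpret low_excess_vertex V E d z using UW by unfold_locales auto
    obtain x where "x \<in> V" "x \<noteq> z" "\<not> E z x" using Wx z by blast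
    then show ?thesis by (rule sum_ex_ge) (fact not_K2)
  next
    case False
    then have c4: "4 \<le> ?c x" if "x \<in> W" for x using that by (metis not_less_eq_eq numeral_3_eq_3 eval_nat_numeral(2) semiring_norm(26-28))
    have W4: "4 * card W \<le> (\<Sum>x\<in>W. ?c x)" using sum_mono[of W "\<lambda>_. 4" ?c] c4 by simp
    show ?thesis
    proof (cases "card U \<le> 2")
      case True
      then show ?thesis using W4 sumW cardV by linarith
    next
      case False
      then have U3: "3 \<le> card U" by simp
      then have Une: "U \<noteq> {}" by auto
      have adjU: "E x p \<and> E p y" if "p \<in> U" "x \<in> V" "y \<in> V" "x \<noteq> y" "\<not> E x y" for p x y
      proof -
        have "E p v" if "v \<in> V" "v \<noteq> p" for v using that \<open>p \<in> U\<close> by (auto simp: U_def)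
        then show ?thesis using that E_sym by blast
      qed
      then have exU: "2 * (card U - 1) \<le> ex x y" if "x \<in> V" "y \<in> V" "x \<noteq> y" "\<not> E x y" for x y
        using ex_common_neighbours[OF that(3,4) Une] that by blast
      \<comment> \<open>If \<open>W\<close> were just \<open>{x0, y0}\<close>, only that single edge
        would be missing, which \<open>not_minus_edge\<close> excludes.\<close>
      obtain v where v: "v \<in> W" "v \<noteq> x0" "v \<noteq> y0"
      proof (rule ccontr)
        assume "\<not> thesis"
        then have W: "W \<subseteq> {x0, y0}" using that by blast
        have "E x y" if "x \<in> V" "y \<in> V" "x \<noteq> y" "{x, y} \<noteq> {x0, y0}" for x y
        proof -
          have "x \<in> U \<or> y \<in> U" using W that by (auto simp: W_def)
          then show ?thesis using that E_commute by (auto simp: U_def)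
        qed
        then show False using not_minus_edge by blast
      qed
      have "card {x0, y0, v} \<le> card W" using xyW v fin by (intro card_mono) auto
      then have W3: "3 \<le> card W" using noncomplete v by auto
      show ?thesis
      proof (cases "card U = 3")
        case True
        \<comment> \<open>With three universal vertices the bound lacks two units, so one vertex
          with 6 instead of 4 suffices. Two nonneighbours give 4 each; if no vertex has two, then
          \<open>v\<close> is a fourth common neighbour of \<open>x0\<close> and
          \<open>y0\<close>.\<close>
        have "\<exists>x\<in>W. 6 \<le> ?c x"
        proof (cases "\<exists>x\<in>W. \<exists>y\<in>V. \<exists>y'\<in>V. y \<noteq> y' \<and> y \<noteq> x \<and> y' \<noteq> x \<and> \<not> E x y \<and> \<not> E x y'")
          case True
          then obtain x y y' where y: "x \<in> W" "y \<in> V" "y' \<in> V" "y \<noteq> y'" "y \<noteq> x" "y' \<noteq> x" "\<not> E x y" "\<not> E x y'"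
            by blast
          have "ex x y + ex x y' \<le> ?c x"
            using sum_mono2[OF finite_V, of "{y, y'}" "ex x"] y by simp
          moreover have "2 * (card U - 1) \<le> ex x y" "2 * (card U - 1) \<le> ex x y'"
            using exU y UW by blast+
          ultimately show ?thesis using y(1) \<open>card U = 3\<close> by (intro bexI[of _ x]) auto
        next
          case False
          then have "E x0 v" "E y0 v" using xyW v noncomplete UW E_commute[of x0 y0] by blast+
          moreover have "E x0 p \<and> E p y0" if "p \<in> U" for p
            using adjU[OF that noncomplete] .
          ultimately have "2 * (card (insert v U) - 1) \<le> ex x0 y0"
            using ex_common_neighbours[OF noncomplete(3,4), of "insert v U"] E_commute[of v y0] by blast
          moreover have "card (insert v U) = 4" using v fin True by (simp add: W_def)
          moreover have "ex x0 y0 \<le> ?c x0" using member_le_sum[of y0 V "ex x0"] noncomplete finite_V by simp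
          ultimately show ?thesis using xyW(1) by (intro bexI[of _ x0]) auto
        qed
        then obtain x where x: "x \<in> W" "6 \<le> ?c x" by blast
        have "4 * card (W - {x}) \<le> (\<Sum>x\<in>W - {x}. ?c x)"
          using sum_mono[of "W - {x}" "\<lambda>_. 4" ?c] c4 by simp
        moreover have "(\<Sum>x\<in>W. ?c x) = ?c x + (\<Sum>x\<in>W - {x}. ?c x)" using sum.remove[OF fin(2) x(1)] .
        moreover have "card (W - {x}) + 1 = card W" using x(1) fin W3 by simp
        ultimately show ?thesis using x(2) sumW cardV True by linarith
      next
        case False
        have "2 * (card U - 1) \<le> ?c x" if "x \<in> W" for x
        proof -
          obtain y where y: "y \<in> V" "y \<noteq> x" "\<not> E x y" using Wx \<open>x \<in> W\<close> by blast
          have "2 * (card U - 1) \<le> ex x y" using exU y \<open>x \<in> W\<close> UW by blast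
          also have "\<dots> \<le> ?c x" using member_le_sum[of y V "ex x"] y finite_V by simp
          finally show ?thesis .
        qed
        then have "card W * (2 * (card U - 1)) \<le> (\<Sum>x\<in>W. ?c x)"
          using sum_mono[of W "\<lambda>_. 2 * (card U - 1)" ?c] by simp
        \<comment> \<open>The substitution turns the claim into \<open>(3 + i) * (6 + 2 * j)\<close>
          being at least \<open>18 + 4 * i + 4 * j\<close>, an equality for
          \<open>i = j = 0\<close>.\<close>
        moreover obtain i where "card W = 3 + i" using W3 le_Suc_ex by blast
        moreover obtain j where "card U = 4 + j" using U3 False le_Suc_ex[of 4 "card U"] by auto
        ultimately show ?thesis using sumW cardV by (simp add: algebra_simps)
      qed
    qed
  qed
qed

end

section \<open>Szeged and Wiener index\<close>

lemma sum_unordered_pairs: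
  fixes f :: "'a \<Rightarrow> 'a \<Rightarrow> nat"
  assumes "finite R" "sym R" "irrefl R" and f: "\<And>a b. f a b = f b a"
  shows "(\<Sum>(a, b)\<in>R. f a b) = 2 * (\<Sum>e\<in>{{a, b} | a b. (a, b) \<in> R}. on_pair f e)"
proof -
  let ?h = "\<lambda>(a, b). {a, b}"
  have im: "{{a, b} | a b. (a, b) \<in> R} = ?h ` R" by force
  have "(\<Sum>p\<in>R. case p of (a, b) \<Rightarrow> f a b) = (\<Sum>e\<in>?h ` R. \<Sum>p\<in>{p \<in> R. ?h p = e}. case p of (a, b) \<Rightarrow> f a b)"
    by (rule sum.image_gen[OF assms(1)])
  also have "\<dots> = (\<Sum>e\<in>?h ` R. 2 * on_pair f e)"
  proof (rule sum.cong[OF refl])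
    fix e assume "e \<in> ?h ` R"
    then obtain a b where ab: "(a, b) \<in> R" "e = {a, b}" by force
    then have "(b, a) \<in> R" "a \<noteq> b" using assms(2,3) by (auto dest: symD simp: irrefl_def)
    then have "{p \<in> R. ?h p = e} = {(a, b), (b, a)}" using ab by (auto simp: doubleton_eq_iff)
    then show "(\<Sum>p\<in>{p \<in> R. ?h p = e}. case p of (a, b) \<Rightarrow> f a b) = 2 * on_pair f e"
      using \<open>a \<noteq> b\<close> ab(2) f[of b a] on_pair_eq[of f a b, OF f] by simp
  qed
  finally show ?thesis by (simp add: im sum_distrib_left)
qed

section \<open>From 2-connected graphs to the abstract metric\<close>

context pair_graph
begin

lemma min_awalk:
  assumes "a \<rightarrow>\<^sup>*\<^bsub>with_proj G\<^esub> b"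
  obtains p where "awalk a p b" "length p = gdist G a b"
proof -
  obtain p0 where "apath a p0 b" using assms by (auto simp: reachable_apath)
  then have "\<exists>k p. apath a p b \<and> length p = k" by blast
  from LeastI_ex[OF this] show thesis using that awalkI_apath unfolding gdist_def by blast
qed

text \<open>\<open>gdist\<close> minimises over paths only; for arbitrary walks the bound comes from
  its agreement with the unit-weight distance \<open>\<mu>\<close>.\<close>

lemma gdist_le_awalk:
  assumes "awalk a p b" shows "gdist G a b \<le> length p"
proof -
  have "ereal (real (gdist G a b)) = \<mu> (\<lambda>_. 1) a b"
    using assms by (intro gdist_eq_mu reachable_awalkI)
  also have "\<dots> \<le> ereal (awalk_cost (\<lambda>_. 1) p)" using min_cost_le_walk_cost[OF assms] .
  finally show ?thesis by (simp add: awalk_cost_def sum_list_triv)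
qed

lemma two_connected_metric:
  assumes "two_connected G"
  shows "graph_metric (pverts G) (\<lambda>x y. (x, y) \<in> parcs G) (gdist G)"
proof -
  have reach: "a \<rightarrow>\<^sup>*\<^bsub>with_proj G\<^esub> b" if "a \<in> pverts G" "b \<in> pverts G" for a b
    using assms that reachable_mk_symmetric_eq[OF sym_arcs]
    by (auto simp: two_connected_def connected_def strongly_connected_def)
  have wit: "\<exists>p. awalk a p b \<and> length p = gdist G a b" if "a \<in> pverts G" "b \<in> pverts G" for a b
    using min_awalk[OF reach[OF that]] by blast
  have arc: "gdist G a b \<le> 1" if "(a, b) \<in> parcs G" for a b
    using gdist_le_awalk[OF arc_implies_awalk[OF that]] by simp
  have zero: "gdist G a b = 0 \<longleftrightarrow> a = b" if "a \<in> pverts G" "b \<in> pverts G" for a b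
  proof
    assume "gdist G a b = 0"
    then have "awalk a [] b" using wit[OF that] by auto
    then show "a = b" by (simp add: awalk_Nil_iff)
  qed (use gdist_le_awalk[of a "[]" a] that in \<open>auto simp: awalk_Nil_iff\<close>)
  have tri: "gdist G a c \<le> gdist G a b + gdist G b c"
    if abc: "a \<in> pverts G" "b \<in> pverts G" "c \<in> pverts G" for a b c
  proof -
    obtain p q where "awalk a p b" "length p = gdist G a b" "awalk b q c" "length q = gdist G b c"
      using wit[OF abc(1,2)] wit[OF abc(2,3)] by blast
    then show ?thesis using gdist_le_awalk[OF awalk_appendI, of a p b q c] by simp
  qed
  have pred: "\<exists>u. (u, b) \<in> parcs G \<and> gdist G a u = k"
    if ab: "a \<in> pverts G" "b \<in> pverts G" "gdist G a b = Suc k" for a b k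
  proof -
    obtain p where p: "awalk a p b" "length p = Suc k" using wit ab by metis
    \<comment> \<open>Dropping the last arc of a shortest walk gives the predecessor; the triangle
      inequality shows that it is not closer than \<open>k\<close>.\<close>
    then obtain q e where qe: "p = q @ [e]" "length q = k" by (metis append_butlast_last_id length_butlast diff_Suc_1 list.size(3) nat.simps(3))
    then have "awalk a q (fst e)" and e: "e \<in> parcs G" "snd e = b"
      using p(1) by (auto simp: awalk_simps)
    then have "gdist G a (fst e) \<le> k" using gdist_le_awalk qe by blast
    moreover have eG: "(fst e, b) \<in> parcs G" using e by auto
    moreover have "gdist G a b \<le> gdist G a (fst e) + gdist G (fst e) b"
      using tri ab eG wellformed'(1) by blast
    ultimately show ?thesis using arc[OF eG] ab by (intro exI[of _ "fst e"]) auto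
  qed
  show ?thesis
  proof
    show "finite (pverts G)" by (rule pair_finite_verts)
    show "gdist G x y = gdist G y x" for x y by (rule gdist_commute)
    show "x \<in> pverts G \<and> y \<in> pverts G" if "(x, y) \<in> parcs G" for x y using that wellformed' by blast
    show "(y, x) \<in> parcs G" if "(x, y) \<in> parcs G" for x y using that by (rule arcs_symmetric)
    show "gdist G x y = 0 \<longleftrightarrow> x = y" if "x \<in> pverts G" "y \<in> pverts G" for x y by (rule zero[OF that])
    show "gdist G x y = 1 \<longleftrightarrow> (x, y) \<in> parcs G" if xy: "x \<in> pverts G" "y \<in> pverts G" for x y
    proof
      assume "gdist G x y = 1"
      then obtain u where "(u, y) \<in> parcs G" "gdist G x u = 0" using pred[OF xy, of 0] by auto
      then show "(x, y) \<in> parcs G" using zero xy wellformed' by metis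
    next
      assume "(x, y) \<in> parcs G"
      then show "gdist G x y = 1" using arc zero[OF xy] no_loops' by (metis le_neq_implies_less less_one)
    qed
  qed (use tri pred in blast)+
qed

text \<open>If no edge left \<open>S\<close> in the graph without \<open>v\<close>, a walk from a
  vertex of \<open>S\<close> could never reach \<open>r\<close>.\<close>

lemma two_connected_cut:
  assumes "two_connected G" "v \<in> pverts G" "S \<subseteq> pverts G - {v}" "S \<noteq> {}"
    and r: "r \<in> pverts G - {v}" "r \<notin> S"
  shows "\<exists>s\<in>S. \<exists>t. t \<notin> S \<and> t \<noteq> v \<and> (s, t) \<in> parcs G"
proof (rule ccontr)
  assume closed: "\<not> ?thesis"
  let ?H = "mk_symmetric (del_vert v)"
  \<comment> \<open>\<open>connected\<close> refers to the symmetrized digraph; as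
    \<open>parcs G\<close> is symmetric, symmetrizing creates no arc outside
    \<open>G\<close>.\<close>
  have H: "parcs ?H \<subseteq> {(x, y). (x, y) \<in> parcs G \<and> x \<noteq> v \<and> y \<noteq> v}"
    using arcs_symmetric by (auto simp: parcs_mk_symmetric del_vert_simps)
  obtain s where s: "s \<in> S" using assms(4) by blast
  have "strongly_connected (with_proj ?H)"
    using assms(1,2) by (simp add: two_connected_def connected_def)
  moreover have "s \<in> verts (with_proj ?H)" "r \<in> verts (with_proj ?H)"
    using s r assms(3) by (auto simp: del_vert_simps)
  ultimately have "s \<rightarrow>\<^sup>*\<^bsub>with_proj ?H\<^esub> r"
    unfolding strongly_connected_def by blast
  then have "(s, r) \<in> (parcs ?H)\<^sup>*" using reachable_rtranclI by fastforce
  then have "r \<in> S" by (induction rule: rtrancl_induct) (use s H closed in auto)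
  then show False using r by blast
qed

text \<open>Double counting: the Szeged summand of an arc is the number of ordered vertex pairs that
  it separates. Counted by pairs instead, this gives distance plus excess, and the distances sum to
  twice the Wiener index.\<close>

lemma eta_eq:
  assumes "two_connected G"
  shows "2 * eta G = int (\<Sum>x\<in>pverts G. \<Sum>y\<in>pverts G.
    graph_metric.ex (\<lambda>x y. (x, y) \<in> parcs G) (gdist G) x y)"
proof -
  interpret M: graph_metric "pverts G" "\<lambda>x y. (x, y) \<in> parcs G" "gdist G"
    using assms by (rule two_connected_metric)
  let ?V = "pverts G" and ?d = "gdist G"
  let ?P = "{(a, b). a \<in> ?V \<and> b \<in> ?V \<and> a \<noteq> b}"
  have finP: "finite ?P" by (rule finite_subset[of _ "?V \<times> ?V"]) auto
  have pairs: "{e. e \<subseteq> ?V \<and> card e = 2} = {{a, b} | a b. (a, b) \<in> ?P}"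
    by (auto simp: card_2_iff)
  have "(\<Sum>(a, b)\<in>?P. ?d a b) = 2 * wiener_index G"
    unfolding wiener_index_def pairs
    by (rule sum_unordered_pairs[OF finP]) (auto simp: sym_def irrefl_def gdist_commute)
  moreover have "(\<Sum>(a, b)\<in>?P. ?d a b) = (\<Sum>(a, b)\<in>?V \<times> ?V. ?d a b)"
    by (rule sum.mono_neutral_left) (auto simp: M.d_self)
  ultimately have W: "2 * wiener_index G = (\<Sum>x\<in>?V. \<Sum>y\<in>?V. ?d x y)"
    by (simp add: sum.cartesian_product)
  have "irrefl (parcs G)" using no_loops' by (auto simp: irrefl_def)
  moreover have "sym (parcs G)" using arcs_symmetric by (auto simp: sym_def)
  ultimately have "2 * szeged_index G = (\<Sum>(a, b)\<in>parcs G. closer G a b * closer G b a)"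
    unfolding szeged_index_def edges_def
    by (intro sum_unordered_pairs[symmetric] pair_finite_arcs) (simp_all add: mult.commute)
  also have "\<dots> = (\<Sum>e\<in>parcs G. card {p \<in> ?V \<times> ?V. e \<in> M.sep (fst p) (snd p)})"
  proof (rule sum.cong[OF refl], clarify)
    fix a b assume "(a, b) \<in> parcs G"
    then have "{p \<in> ?V \<times> ?V. (a, b) \<in> M.sep (fst p) (snd p)}
        = {x \<in> ?V. ?d x a < ?d x b} \<times> {x \<in> ?V. ?d x b < ?d x a}"
      by (auto simp: M.sep_def)
    then show "closer G a b * closer G b a = card {p \<in> ?V \<times> ?V. (a, b) \<in> M.sep (fst p) (snd p)}"
      by (simp add: closer_def card_cartesian_product)
  qed
  also have "\<dots> = (\<Sum>p\<in>?V \<times> ?V. card {e \<in> parcs G. e \<in> M.sep (fst p) (snd p)})"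
    using sum.swap_restrict[of "parcs G" "?V \<times> ?V" "\<lambda>_ _. 1 :: nat" "\<lambda>e p. e \<in> M.sep (fst p) (snd p)"]
    by simp
  also have "\<dots> = (\<Sum>x\<in>?V. \<Sum>y\<in>?V. card {e \<in> parcs G. e \<in> M.sep x y})"
    by (simp add: sum.cartesian_product case_prod_unfold)
  also have "\<dots> = (\<Sum>x\<in>?V. \<Sum>y\<in>?V. ?d x y + M.ex x y)"
  proof (intro sum.cong refl)
    fix x y assume "x \<in> ?V" "y \<in> ?V"
    moreover have "{e \<in> parcs G. e \<in> M.sep x y} = M.sep x y" by (auto simp: M.sep_def)
    ultimately show "card {e \<in> parcs G. e \<in> M.sep x y} = ?d x y + M.ex x y" by (simp add: M.card_sep)
  qed
  finally have "2 * szeged_index G = 2 * wiener_index G + (\<Sum>x\<in>?V. \<Sum>y\<in>?V. M.ex x y)"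
    by (simp add: W sum.distrib)
  then have "int (2 * szeged_index G) = int (2 * wiener_index G) + int (\<Sum>x\<in>?V. \<Sum>y\<in>?V. M.ex x y)"
    by (metis of_nat_add)
  then show ?thesis by (simp add: eta_def)
qed

text \<open>Recognises the graph from one vertex \<open>v\<close> whose removal leaves a clique;
  only the number of neighbours of \<open>v\<close> matters then.\<close>

lemma iso_K_sup:
  assumes v: "v \<in> pverts G" and T: "\<And>x. (v, x) \<in> parcs G \<longleftrightarrow> x \<in> T"
    and clique: "\<And>x y. x \<in> pverts G - {v} \<Longrightarrow> y \<in> pverts G - {v} \<Longrightarrow> x \<noteq> y \<Longrightarrow> (x, y) \<in> parcs G"
  shows "digraph_iso (with_proj G) (with_proj (K_sup (card (pverts G)) (card T)))"
proof -
  let ?V = "pverts G" and ?n = "card (pverts G)" and ?t = "card T"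
  have TV: "T \<subseteq> ?V - {v}" using T wellformed' no_loops' by blast
  have finT: "finite T" using TV by (rule finite_subset) simp
  have n: "card (?V - {v}) = ?n - 1" "1 \<le> ?n" using v card_gt_0_iff[of ?V] by auto
  have t: "?t \<le> ?n - 1" using card_mono[OF _ TV] n by simp
  obtain f where f: "bij_betw f T {..<?t}"
    using finite_same_card_bij[of T "{..<?t}"] finT by auto
  have "card (?V - {v} - T) = card {?t..<?n - 1}"
    using card_Diff_subset[OF finT TV] n by simp
  then obtain g where g: "bij_betw g (?V - {v} - T) {?t..<?n - 1}"
    using finite_same_card_bij[of "?V - {v} - T" "{?t..<?n - 1}"] by auto
  \<comment> \<open>The numbering matches \<open>K_sup\<close>: the neighbours of \<open>v\<close>
    come first, then the other old vertices, and \<open>v\<close> is the last vertex.\<close>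
  define h where "h x = (if x = v then ?n - 1 else if x \<in> T then f x else g x)" for x
  have "h x = f x" if "x \<in> T" for x using that TV by (auto simp: h_def)
  then have hT: "bij_betw h T {..<?t}" using f bij_betw_cong[of T h f] by simp
  have "h x = g x" if "x \<in> ?V - {v} - T" for x using that by (auto simp: h_def)
  then have "bij_betw h (?V - {v} - T) {?t..<?n - 1}" using g bij_betw_cong[of "?V - {v} - T" h g] by blast
  then have "bij_betw h (T \<union> (?V - {v} - T)) ({..<?t} \<union> {?t..<?n - 1})"
    by (intro bij_betw_combine hT) auto
  moreover have "T \<union> (?V - {v} - T) = ?V - {v}" "{..<?t} \<union> {?t..<?n - 1} = {..<?n - 1}"
    using TV t by auto
  ultimately have hV: "bij_betw h (?V - {v}) {..<?n - 1}" by simp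
  have hv: "h v = ?n - 1" by (simp add: h_def)
  have "bij_betw h ((?V - {v}) \<union> {v}) ({..<?n - 1} \<union> {?n - 1})"
    using hv by (intro bij_betw_combine hV) (auto simp: bij_betw_def)
  moreover have "(?V - {v}) \<union> {v} = ?V" "{..<?n - 1} \<union> {?n - 1} = {..<?n}" using v n by auto
  ultimately have h: "bij_betw h ?V {..<?n}" by simp
  let ?C = "{(x, y). x \<in> ?V - {v} \<and> y \<in> ?V - {v} \<and> x \<noteq> y}"
  have arcs: "parcs G = ?C \<union> T \<times> {v} \<union> {v} \<times> T"
  proof (intro set_eqI, clarify)
    fix x y
    show "(x, y) \<in> parcs G \<longleftrightarrow> (x, y) \<in> ?C \<union> T \<times> {v} \<union> {v} \<times> T"
      using T[of x] T[of y] clique[of x y] arcs_symmetric[of x y] arcs_symmetric[of y x]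
        wellformed'[of x y] no_loops'[of x y] by blast
  qed
  have "map_prod h h ` ?C = {(x, y). x < ?n - 1 \<and> y < ?n - 1 \<and> x \<noteq> y}"
  proof (intro set_eqI iffI)
    fix e assume "e \<in> map_prod h h ` ?C"
    then show "e \<in> {(x, y). x < ?n - 1 \<and> y < ?n - 1 \<and> x \<noteq> y}"
      using hV bij_betwE[OF hV] by (auto dest: inj_onD[OF bij_betw_imp_inj_on[OF hV]])
  next
    fix e assume "e \<in> {(x, y). x < ?n - 1 \<and> y < ?n - 1 \<and> x \<noteq> y}"
    then obtain x y where e: "e = (x, y)" "x \<in> h ` (?V - {v})" "y \<in> h ` (?V - {v})" "x \<noteq> y"
      using bij_betw_imp_surj_on[OF hV] by auto
    then obtain x' y' where "x = h x'" "y = h y'" "x' \<in> ?V - {v}" "y' \<in> ?V - {v}" by blast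
    then have "(x', y') \<in> ?C" "e = map_prod h h (x', y')" using e by auto
    then show "e \<in> map_prod h h ` ?C" by blast
  qed
  moreover have "map_prod h h ` (T \<times> {v}) = {..<?t} \<times> {?n - 1}"
    "map_prod h h ` ({v} \<times> T) = {?n - 1} \<times> {..<?t}"
    using bij_betw_imp_surj_on[OF hT] hv by (auto simp: map_prod_surj_on)
  ultimately have him: "map_prod h h ` parcs G = parcs (K_sup ?n ?t)"
    unfolding arcs image_Un by (simp add: K_sup_def)
  have inj: "inj_on h ?V" and "h ` ?V = pverts (K_sup ?n ?t)"
    using h by (auto simp: bij_betw_def K_sup_def)
  moreover have "inj_on (map_prod h h) (parcs G)"
    by (rule inj_on_subset[OF map_prod_inj_on[OF inj inj]]) (use wellformed' in auto)
  moreover have "wf_digraph (with_proj G)" by unfold_locales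
  ultimately show ?thesis
    unfolding digraph_iso_def digraph_isomorphism_def
    by (intro exI[of _ "\<lparr>iso_verts = h, iso_arcs = map_prod h h, iso_head = snd, iso_tail = fst\<rparr>"])
      (auto simp: app_iso_def with_proj_def[of "K_sup ?n ?t"] him)
qed

end

theorem theorem4:
  fixes G :: "'a pair_pre_digraph" and n :: nat
  assumes "pair_graph G"
    and "card (pverts G) = n"
    and "two_connected G"
    and "\<not> complete_digraph n (with_proj G)"
    and "\<not> digraph_iso (with_proj G) (with_proj (K_sup n 2))"
    and "\<not> digraph_iso (with_proj G) (with_proj (K_sup n (n - 2)))"
  shows "eta G \<ge> 2 * int n - 5"
proof -
  interpret pair_graph G by fact
  let ?V = "pverts G" and ?E = "\<lambda>x y. (x, y) \<in> parcs G"
  interpret graph_metric ?V ?E "gdist G" using assms(3) by (rule two_connected_metric)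
  interpret biconnected_metric ?V ?E "gdist G"
    by unfold_locales (rule two_connected_cut[OF assms(3)])
  have "parcs G \<noteq> {(u, v). (u, v) \<in> ?V \<times> ?V \<and> u \<noteq> v}"
    using assms(2,4) pair_finite_verts by (simp add: complete_digraph_pair_def)
  moreover have "parcs G \<subseteq> {(u, v). (u, v) \<in> ?V \<times> ?V \<and> u \<noteq> v}"
    using E_in_V E_neq by blast
  ultimately obtain x y where xy: "x \<in> ?V" "y \<in> ?V" "x \<noteq> y" "(x, y) \<notin> parcs G" by blast
  have "4 * card ?V \<le> (\<Sum>x\<in>?V. \<Sum>y\<in>?V. ex x y) + 10"
  proof (rule sum_ex_ge[OF xy])
    fix w p q assume w: "p \<noteq> q" "w \<in> ?V" "\<And>x. (w, x) \<in> parcs G \<longleftrightarrow> x = p \<or> x = q"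
      and clique: "\<And>x y. x \<in> ?V - {w} \<Longrightarrow> y \<in> ?V - {w} \<Longrightarrow> x \<noteq> y \<Longrightarrow> (x, y) \<in> parcs G"
    have "digraph_iso (with_proj G) (with_proj (K_sup (card ?V) (card {p, q})))"
      by (rule iso_K_sup[OF w(2)]) (use w(3) clique in auto)
    then show False using assms(2,5) w(1) by (simp add: numeral_2_eq_2)
  next
    show "\<not> (\<forall>u\<in>?V. \<forall>v\<in>?V. u \<noteq> v \<longrightarrow> {u, v} \<noteq> {x, y} \<longrightarrow> (u, v) \<in> parcs G)"
    proof
      assume adj: "\<forall>u\<in>?V. \<forall>v\<in>?V. u \<noteq> v \<longrightarrow> {u, v} \<noteq> {x, y} \<longrightarrow> (u, v) \<in> parcs G"
      \<comment> \<open>With a single missing edge, its end \<open>x\<close> plays the new vertex: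
        it is adjacent to all others but \<open>y\<close>, and the rest is a clique.\<close>
      have "(x, v) \<in> parcs G \<longleftrightarrow> v \<in> ?V - {x, y}" for v
        using adj xy E_in_V[of x v] E_irrefl[of x] by (auto simp: doubleton_eq_iff)
      then have "digraph_iso (with_proj G) (with_proj (K_sup (card ?V) (card (?V - {x, y}))))"
        by (rule iso_K_sup[OF xy(1)]) (use adj in \<open>auto simp: doubleton_eq_iff\<close>)
      moreover have "card (?V - {x, y}) = n - 2"
        using xy assms(2) by (simp add: card_Diff_subset)
      ultimately show False using assms(2,6) by simp
    qed
  qed
  \<comment> \<open>Halving \<open>4 * n - 10\<close> gives the bound
    \<open>2 * n - 5\<close>.\<close>
  moreover have "2 * eta G = int (\<Sum>x\<in>?V. \<Sum>y\<in>?V. ex x y)" using assms(3) by (rule eta_eq)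
  ultimately show ?thesis using assms(2) by linarith
qed

end
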